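(* Let $R$ be a large ideal domain (LID), let $t\in\mathbb{N}$ and, for each $i=1,\dots,t$, let $(\Omega_i,\mu_i)$ be a probability space, let $(T_g^{(i)})_{g\in\mathcal{A}_R}$ be a measure preserving action of the affine semigroup $\mathcal{A}_R$ of $R$ on $(\Omega_i,\mu_i)$, and let $B_i\subset\Omega_i$ be a measurable set with $\mu_i(B_i)>0$. Let $\delta\in(0,1)$ and, for each $i$, put $$R(B_i,\delta):=\Big\{u\in R\setminus\{0\}:\ \mu_i\big((T^{(i)}_{M_u})^{-1}B_i\cap (T^{(i)}_{A_u})^{-1}B_i\big)>\delta\,\mu_i(B_i)^2\Big\}.$$ Then the intersection $R(B_1,\delta)\cap\dots\cap R(B_t,\delta)$ is affinely syndetic in $R$ (and, in particular, nonempty).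
   Context: A ring $R$ is a large ideal domain (LID) if it is an infinite countable integral domain (commutative with $1$) such that for every $x\in R\setminus\{0\}$ the ideal $xR$ has finite index in $R$ as an additive subgroup. The affine semigroup $\mathcal{A}_R$ is the semigroup, under composition, of all maps $R\to R$ of the form $x\mapsto ux+v$ with $u\in R\setminus\{0\}$, $v\in R$. Write $A_v:x\mapsto x+v$ for $v\in R$ and $M_u:x\mapsto ux$ for $u\in R\setminus\{0\}$. A measure preserving action $(T_g)_{g\in\mathcal{A}_R}$ on a probability space $(\Omega,\mu)$ consists of measurable maps $T_g:\Omega\to\Omega$ with $T_gT_h=T_{gh}$ and $\mu(T_g^{-1}B)=\mu(B)$ for all measurable $B$. A set $S\subset R$ is affinely syndetic if there is a finite set $F\subset\mathcal{A}_R$ such that for every $x\in R$ there is $g\in F$ with $g(x)\in S$. *)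

theory Defs
  imports "HOL-Probability.Probability"
begin

(* The ring is the whole type. The finite-index axiom counts the additive cosets a + xR. *)
class large_ideal_domain = idom +
  assumes infinite_ring: "infinite (UNIV :: 'a set)"
    and countable_ring: "countable (UNIV :: 'a set)"
    and finite_index: "x \<noteq> 0 \<Longrightarrow> finite (range (\<lambda>a. (\<lambda>y. a + y) ` range (\<lambda>r. x * r)))"

definition add_map :: "'a::idom \<Rightarrow> 'a \<Rightarrow> 'a" where
  "add_map v = (\<lambda>x. x + v)"

definition mult_map :: "'a::idom \<Rightarrow> 'a \<Rightarrow> 'a" where
  "mult_map u = (\<lambda>x. u * x)"

definition affine_semigroup :: "('a::idom \<Rightarrow> 'a) set" where
  "affine_semigroup = {(\<lambda>x. u * x + v) | u v. u \<noteq> 0}"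

(* Preimages are cut down to the space, and the composition law is required only there. As the
   index set is a semigroup, the identity map is not required to act as the identity. *)
definition measure_preserving_action ::
    "'w measure \<Rightarrow> (('a::idom \<Rightarrow> 'a) \<Rightarrow> 'w \<Rightarrow> 'w) \<Rightarrow> bool" where
  "measure_preserving_action M T \<longleftrightarrow>
     (\<forall>g\<in>affine_semigroup. T g \<in> M \<rightarrow>\<^sub>M M) \<and>
     (\<forall>g\<in>affine_semigroup. \<forall>h\<in>affine_semigroup. \<forall>\<omega>\<in>space M. T g (T h \<omega>) = T (g \<circ> h) \<omega>) \<and>
     (\<forall>g\<in>affine_semigroup. \<forall>B\<in>sets M. emeasure M (T g -` B \<inter> space M) = emeasure M B)"

definition affinely_syndetic :: "'a::idom set \<Rightarrow> bool" where
  "affinely_syndetic S \<longleftrightarrow>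
     (\<exists>F. finite F \<and> F \<subseteq> affine_semigroup \<and> (\<forall>x. \<exists>g\<in>F. g x \<in> S))"

definition return_set ::
    "'w measure \<Rightarrow> (('a::idom \<Rightarrow> 'a) \<Rightarrow> 'w \<Rightarrow> 'w) \<Rightarrow> 'w set \<Rightarrow> real \<Rightarrow> 'a set" where
  "return_set M T B \<delta> =
     {u. u \<noteq> 0 \<and>
         measure M ((T (mult_map u) -` B \<inter> space M) \<inter> (T (add_map u) -` B \<inter> space M))
           > \<delta> * (measure M B)\<^sup>2}"

end

theory Submission
  imports Defs "HOL-Library.Ramsey" "HOL-Library.Function_Algebras"
begin

text \<open>Suppose that the common return set is not affinely syndetic. Its complement, without
  \<open>0\<close>, \<open>1\<close> and \<open>-1\<close>, is a set \<open>E\<close> containing \<open>F x\<close> for suitable \<open>x\<close> whenever \<open>F\<close> is a finite set of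
  affine maps. In \<open>L\<^sup>2\<close> split \<open>V_b = 1_B \<circ> M_b\<close> as \<open>g_b + h_b\<close>, where \<open>g_b\<close> is its projection to the vectors
  with totally bounded orbit under the additive group. By a mean ergodic argument for Hilbert-Schmidt
  operators, \<open>h_b\<close> is weakly mixing; finiteness of the index of \<open>c R\<close> makes this insensitive to replacing
  the action of \<open>v\<close> by that of \<open>c v\<close>. Hence one can choose \<open>b_0, b_1, ...\<close> inductively such that, with
  \<open>c = b_m / b_l\<^sup>2\<close>, the ratio \<open>b_m / b_l = b_l c\<close> lies in \<open>E\<close>, \<open>A_c\<close> almost fixes \<open>g_(b_l)\<close>, and the vectors
  \<open>A_c h_(b_l)\<close>, \<open>l < m\<close>, are almost orthogonal. The correlation of \<open>B\<close> at \<open>u = b_m / b_l\<close> is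
  \<open>\<langle>V_(b_m), A_c V_(b_l)\<rangle>\<close>, which averaged over \<open>l\<close> is close to the average of \<open>\<langle>g_(b_m), g_(b_l)\<rangle>\<close>. Ramsey's
  theorem yields an infinite set of indices for whose pairs one and the same system has small
  correlation; there the Gram matrix of the \<open>g_b\<close>, all with integral \<open>\<mu>(B)\<close>, gives a contradiction.\<close>

section \<open>Thick sets, finite colourings and weighted averages\<close>

text \<open>\<open>V_(b_m)\<close> is unknown while the shifts \<open>c\<close> are chosen, because
  \<open>b_m\<close> is built from them. So its products with the \<open>A_c h_(b_l)\<close> cannot
  be made small one by one; mutual almost orthogonality of these vectors can be arranged, and it
  makes their sum small against every bounded vector. The price is that only sums over
  \<open>l\<close> are controlled, so a contradiction needs many indices all of whose pairs fail in
  one system. There is no division, so \<open>b_m\<close> is sought as \<open>D x\<close> with one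
  free element \<open>x\<close>, where \<open>D\<close> is the product of the squares of the earlier
  terms; the shift for \<open>l\<close> is then \<open>(D / b_l\<^sup>2) x\<close>. The product of
  two shifted vectors depends on the difference of their shifts, which for nonzero \<open>x\<close>
  vanishes iff the squares of the two terms agree, that is, iff their ratio is \<open>1\<close> or
  \<open>-1\<close>: hence these leave \<open>E\<close>. The point \<open>0\<close> leaves because
  return times are nonzero. A thick set can be sparse for any fixed averaging scheme, so smallness
  on average must be uniform over translates before it can be combined with
  \<open>E\<close>.\<close>

definition thick :: "'a::idom set \<Rightarrow> bool" where
  "thick E \<longleftrightarrow> (\<forall>F. finite F \<longrightarrow> F \<subseteq> affine_semigroup \<longrightarrow> (\<exists>x. \<forall>g\<in>F. g x \<in> E))"

lemma thickD:
  "thick E \<Longrightarrow> finite F \<Longrightarrow> F \<subseteq> affine_semigroup \<Longrightarrow> \<exists>x. \<forall>g\<in>F. g x \<in> E"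
  by (simp add: thick_def)

lemma affine_semigroup_translate:
  assumes "g \<in> affine_semigroup"
  shows "(\<lambda>x. g (x + v)) \<in> affine_semigroup"
proof -
  obtain u w where g: "g = (\<lambda>x. u * x + w)" "u \<noteq> 0"
    using assms unfolding affine_semigroup_def by blast
  then have "(\<lambda>x. g (x + v)) = (\<lambda>x. u * x + (u * v + w))"
    by (auto simp: algebra_simps)
  then show ?thesis
    using g unfolding affine_semigroup_def by blast
qed

lemma scaling_in_affine_semigroup: "u \<noteq> 0 \<Longrightarrow> (\<lambda>x. u * x) \<in> affine_semigroup"
  unfolding affine_semigroup_def by (intro CollectI exI[of _ u] exI[of _ 0]) simp

lemma affine_inj: "g \<in> affine_semigroup \<Longrightarrow> g x = g y \<Longrightarrow> x = y"
  unfolding affine_semigroup_def by auto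

text \<open>Applying the failure of syndeticity to all translates \<open>g (x + v)\<close> yields
  one \<open>x\<close> that serves every \<open>v\<close> in \<open>V\<close>. Affine maps are
  injective, so each pair of a map in \<open>F\<close> and a point of \<open>Z\<close> spoils at
  most one \<open>v\<close>; one more translate than there are such pairs is enough to miss
  \<open>Z\<close>.\<close>

lemma thick_if_not_syndetic:
  fixes S Z :: "'a::idom set"
  assumes inf: "infinite (UNIV :: 'a set)" and S: "\<not> affinely_syndetic S" and Z: "finite Z"
  shows "thick (- S - Z)"
  unfolding thick_def
proof (intro allI impI)
  fix F :: "('a \<Rightarrow> 'a) set"
  assume F: "finite F" "F \<subseteq> affine_semigroup"
  obtain V :: "'a set" where V: "finite V" "card V = card (F \<times> Z) + 1"
    using infinite_arbitrarily_large[OF inf] by blast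
  define G where "G = (\<lambda>(g, v) x. g (x + v)) ` (F \<times> V)"
  have "G \<subseteq> affine_semigroup"
    unfolding G_def
  proof clarsimp
    fix g v
    assume "g \<in> F"
    then show "(\<lambda>x. g (x + v)) \<in> affine_semigroup"
      using affine_semigroup_translate[of g v] F(2) by blast
  qed
  moreover have "finite G"
    unfolding G_def using F(1) V(1) by (intro finite_imageI finite_cartesian_product)
  ultimately have "affinely_syndetic S" if "\<forall>x. \<exists>g\<in>G. g x \<in> S"
    unfolding affinely_syndetic_def using that by (intro exI[of _ G] conjI)
  then obtain x where x: "\<forall>g\<in>G. g x \<notin> S"
    using S by auto
  have x: "g (x + v) \<notin> S" if "g \<in> F" "v \<in> V" for g v
  proof -
    have "(\<lambda>x. g (x + v)) \<in> G"
      unfolding G_def using that by (intro image_eqI[of _ _ "(g, v)"]) auto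
    from bspec[OF x this] show ?thesis
      by simp
  qed
  have "\<exists>v\<in>V. \<forall>g\<in>F. g (x + v) \<notin> Z"
  proof (rule ccontr)
    assume "\<not> ?thesis"
    then obtain h where h: "\<And>v. v \<in> V \<Longrightarrow> h v \<in> F \<and> h v (x + v) \<in> Z"
      by metis
    have "inj_on (\<lambda>v. (h v, h v (x + v))) V"
    proof (rule inj_onI)
      fix v w
      assume v: "v \<in> V" and eq: "(h v, h v (x + v)) = (h w, h w (x + w))"
      have "h v \<in> affine_semigroup"
        using h[OF v] F by blast
      moreover have "h v (x + v) = h v (x + w)"
        using eq by (metis prod.inject)
      ultimately have "x + v = x + w"
        by (rule affine_inj)
      then show "v = w"
        by simp
    qed
    then have "card V \<le> card (F \<times> Z)"
      using h F Z by (intro card_inj_on_le[where f = "\<lambda>v. (h v, h v (x + v))"]) auto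
    then show False
      using V by simp
  qed
  then obtain v where "v \<in> V" "\<forall>g\<in>F. g (x + v) \<notin> Z"
    by blast
  then show "\<exists>x. \<forall>g\<in>F. g x \<in> - S - Z"
    using x by (intro exI[of _ "x + v"]) auto
qed

text \<open>A finite partition on whose classes \<open>r\<close> holds; \<open>r\<close> itself need
  not be transitive. Colours are natural numbers so that no further type enters, and
  \<open>finitely_colourableI\<close> recodes any finite-valued colouring.\<close>

definition finitely_colourable :: "('a \<Rightarrow> 'a \<Rightarrow> bool) \<Rightarrow> bool" where
  "finitely_colourable r \<longleftrightarrow>
     (\<exists>col :: 'a \<Rightarrow> nat. finite (range col) \<and> (\<forall>s t. col s = col t \<longrightarrow> r s t))"

lemma finitely_colourableI:
  fixes f :: "'a \<Rightarrow> 'b"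
  assumes "finite (range f)" and "\<And>s t. f s = f t \<Longrightarrow> r s t"
  shows "finitely_colourable r"
proof -
  obtain g :: "'b \<Rightarrow> nat" where g: "inj_on g (range f)"
    using finite_imp_inj_to_nat_seg[OF assms(1)] by metis
  have "finite (range (g \<circ> f))"
    using assms(1) by (metis finite_imageI image_comp)
  moreover have "\<forall>s t. (g \<circ> f) s = (g \<circ> f) t \<longrightarrow> r s t"
    using g assms(2) by (auto dest: inj_onD)
  ultimately show ?thesis
    unfolding finitely_colourable_def by blast
qed

lemma finitely_colourable_conj:
  assumes "finitely_colourable r" and "finitely_colourable q"
  shows "finitely_colourable (\<lambda>s t. r s t \<and> q s t)"
proof -
  obtain f g :: "'a \<Rightarrow> nat" where fg: "finite (range f)" "finite (range g)"
      "\<And>s t. f s = f t \<Longrightarrow> r s t" "\<And>s t. g s = g t \<Longrightarrow> q s t"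
    using assms unfolding finitely_colourable_def by metis
  have "range (\<lambda>s. (f s, g s)) \<subseteq> range f \<times> range g"
    by auto
  then have "finite (range (\<lambda>s. (f s, g s)))"
    using fg(1,2) by (meson finite_SigmaI finite_subset)
  then show ?thesis
    by (rule finitely_colourableI) (use fg in auto)
qed

lemma finitely_colourable_Ball:
  assumes "finite I" and "\<And>i. i \<in> I \<Longrightarrow> finitely_colourable (r i)"
  shows "finitely_colourable (\<lambda>s t. \<forall>i\<in>I. r i s t)"
  using assms
proof (induction I)
  case empty
  show ?case
    by (rule finitely_colourableI[of "\<lambda>_. ()"]) auto
next
  case (insert i I)
  have "finitely_colourable (\<lambda>s t. r i s t \<and> (\<forall>j\<in>I. r j s t))"
    by (rule finitely_colourable_conj) (use insert in auto)
  then show ?case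
    by simp
qed

lemma finitely_colourable_comp:
  assumes "finitely_colourable r"
  shows "finitely_colourable (\<lambda>s t. r (f s) (f t))"
proof -
  obtain g :: "'a \<Rightarrow> nat" where g: "finite (range g)" "\<And>s t. g s = g t \<Longrightarrow> r s t"
    using assms unfolding finitely_colourable_def by metis
  have "finite (range (g \<circ> f))"
    by (rule finite_subset[OF _ g(1)]) auto
  then show ?thesis
    by (rule finitely_colourableI) (use g in auto)
qed

lemma finitely_colourable_mono:
  assumes "finitely_colourable r" and "\<And>s t. r s t \<Longrightarrow> q s t"
  shows "finitely_colourable q"
  using assms unfolding finitely_colourable_def by meson

definition wsum :: "(real \<times> 'b) list \<Rightarrow> ('b \<Rightarrow> real) \<Rightarrow> real" where
  "wsum L f = (\<Sum>p\<leftarrow>L. fst p * f (snd p))"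

definition is_weights :: "(real \<times> 'b) list \<Rightarrow> bool" where
  "is_weights L \<longleftrightarrow> (\<forall>p\<in>set L. 0 \<le> fst p) \<and> (\<Sum>p\<leftarrow>L. fst p) = 1"

lemma wsum_Nil [simp]: "wsum [] f = 0"
  and wsum_Cons [simp]: "wsum (p # L) f = fst p * f (snd p) + wsum L f"
  and wsum_append [simp]: "wsum (L @ L') f = wsum L f + wsum L' f"
  by (simp_all add: wsum_def)

lemma wsum_add: "wsum L (\<lambda>x. f x + g x) = wsum L f + wsum L g"
  by (induction L) (simp_all add: algebra_simps)

lemma wsum_cmult: "wsum L (\<lambda>x. c * f x) = c * wsum L f"
  by (induction L) (simp_all add: algebra_simps)

lemma wsum_product: "wsum L (\<lambda>x. wsum L' (\<lambda>y. f x * g y)) = wsum L f * wsum L' g"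
  unfolding wsum_cmult by (induction L) (simp_all add: algebra_simps)

lemma wsum_zero [simp]: "wsum L (\<lambda>x. 0) = 0"
  by (induction L) simp_all

lemma wsum_sum: "wsum L (\<lambda>x. \<Sum>i\<in>I. f i x) = (\<Sum>i\<in>I. wsum L (f i))"
  by (induction L) (simp_all add: sum_distrib_left sum.distrib)

lemma wsum_swap: "wsum L (\<lambda>x. wsum L' (f x)) = wsum L' (\<lambda>y. wsum L (\<lambda>x. f x y))"
  by (induction L) (simp_all add: wsum_add wsum_cmult)

lemma wsum_scale: "wsum (map (apfst ((*) c)) L) f = c * wsum L f"
  by (induction L) (simp_all add: algebra_simps)

lemma wsum_map: "wsum (map (apsnd h) L) f = wsum L (\<lambda>x. f (h x))"
  by (induction L) simp_all

lemma wsum_mono_nonneg: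
  "(\<And>p. p \<in> set L \<Longrightarrow> 0 \<le> fst p) \<Longrightarrow> (\<And>x. x \<in> snd ` set L \<Longrightarrow> f x \<le> g x)
    \<Longrightarrow> wsum L f \<le> wsum L g"
  by (induction L) (auto intro!: add_mono mult_left_mono)

lemma wsum_mono:
  "is_weights L \<Longrightarrow> (\<And>x. x \<in> snd ` set L \<Longrightarrow> f x \<le> g x) \<Longrightarrow> wsum L f \<le> wsum L g"
  by (rule wsum_mono_nonneg) (auto simp: is_weights_def)

lemma wsum_const: "is_weights L \<Longrightarrow> wsum L (\<lambda>x. c) = c"
proof -
  have "wsum L (\<lambda>x. c) = c * (\<Sum>p\<leftarrow>L. fst p)"
    by (induction L) (simp_all add: algebra_simps)
  then show "is_weights L \<Longrightarrow> wsum L (\<lambda>x. c) = c"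
    by (simp add: is_weights_def)
qed

lemma wsum_le: "is_weights L \<Longrightarrow> (\<And>x. x \<in> snd ` set L \<Longrightarrow> f x \<le> c) \<Longrightarrow> wsum L f \<le> c"
  using wsum_mono[of L f "\<lambda>_. c"] by (simp add: wsum_const)

lemma wsum_attains:
  assumes "is_weights L" and "c \<le> wsum L f"
  shows "\<exists>x\<in>snd ` set L. c \<le> f x"
proof (rule ccontr)
  assume neg: "\<not> ?thesis"
  have ne: "L \<noteq> []"
    using assms(1) by (auto simp: is_weights_def)
  define d where "d = Max (f ` snd ` set L)"
  have "wsum L f \<le> d"
    by (rule wsum_le[OF assms(1)]) (simp add: d_def)
  moreover have "d \<in> f ` snd ` set L"
    unfolding d_def using ne by (intro Max_in) auto
  ultimately show False
    using neg assms(2) by auto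
qed

definition conv :: "(real \<times> 'a::plus) list \<Rightarrow> (real \<times> 'a) list \<Rightarrow> (real \<times> 'a) list" where
  "conv L L' = concat (map (\<lambda>p. map (\<lambda>q. (fst p * fst q, snd p + snd q)) L') L)"

lemma wsum_conv: "wsum (conv L L') f = wsum L (\<lambda>v. wsum L' (\<lambda>w. f (v + w)))"
proof -
  have "wsum (map (\<lambda>q. (a * fst q, v + snd q)) L') f = a * wsum L' (\<lambda>w. f (v + w))" for a v
    by (induction L') (simp_all add: algebra_simps)
  then show ?thesis
    by (induction L) (simp_all add: conv_def)
qed

lemma is_weights_conv:
  assumes "is_weights L" "is_weights L'"
  shows "is_weights (conv L L')"
proof -
  have sum_fst: "(\<Sum>p\<leftarrow>L. fst p) = wsum L (\<lambda>_. 1)" for L :: "(real \<times> 'a) list"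
    by (simp add: wsum_def)
  have "wsum (conv L L') (\<lambda>_. 1) = 1"
    using assms by (simp add: wsum_conv wsum_const)
  then show ?thesis
    using assms unfolding is_weights_def sum_fst by (auto simp: conv_def)
qed

text \<open>Uniformity in \<open>x\<close> keeps the average small wherever a thick set forces the
  base point to lie. Using the same weights for \<open>v\<close> and \<open>w\<close> suits the
  pigeonhole principle: a colour of mass \<open>p\<close> carries pairs of mass
  \<open>p\<^sup>2\<close>.\<close>

definition null_function :: "('a::ab_group_add \<Rightarrow> real) \<Rightarrow> bool" where
  "null_function \<psi> \<longleftrightarrow> (\<forall>s. 0 \<le> \<psi> s) \<and>
     (\<forall>\<epsilon>>0. \<exists>L. is_weights L \<and> (\<forall>x. wsum L (\<lambda>v. wsum L (\<lambda>w. \<psi> (x + v - w))) \<le> \<epsilon>))"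

text \<open>Convolved weights serve both functions: for either of them the other weight only moves
  the base point, and the bounds are uniform in it.\<close>

lemma null_function_add:
  assumes "null_function f" "null_function g"
  shows "null_function (\<lambda>s. f s + g s)"
  unfolding null_function_def
proof (intro conjI allI impI)
  show "0 \<le> f s + g s" for s
    using assms unfolding null_function_def by (simp add: add_nonneg_nonneg)
  fix \<epsilon> :: real
  assume "\<epsilon> > 0"
  then have "\<epsilon> / 2 > 0"
    by simp
  then obtain L L' where L: "is_weights L" "\<And>x. wsum L (\<lambda>v. wsum L (\<lambda>w. f (x + v - w))) \<le> \<epsilon> / 2"
    and L': "is_weights L'" "\<And>x. wsum L' (\<lambda>v. wsum L' (\<lambda>w. g (x + v - w))) \<le> \<epsilon> / 2"
    using assms unfolding null_function_def by meson
  let ?C = "conv L L'"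
  have "wsum ?C (\<lambda>v. wsum ?C (\<lambda>w. f (x + v - w) + g (x + v - w))) \<le> \<epsilon>" for x
  proof -
    have "wsum ?C (\<lambda>v. wsum ?C (\<lambda>w. f (x + v - w)))
        = wsum L' (\<lambda>v'. wsum L' (\<lambda>w'. wsum L (\<lambda>v. wsum L (\<lambda>w. f ((x + v' - w') + v - w)))))"
      unfolding wsum_conv
      by (subst (2) wsum_swap, subst (1) wsum_swap, subst (2) wsum_swap)
         (simp add: algebra_simps)
    also have "\<dots> \<le> \<epsilon> / 2"
      by (intro wsum_le L' L)
    finally have 1: "wsum ?C (\<lambda>v. wsum ?C (\<lambda>w. f (x + v - w))) \<le> \<epsilon> / 2" .
    have "wsum ?C (\<lambda>v. wsum ?C (\<lambda>w. g (x + v - w)))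
        = wsum L (\<lambda>v. wsum L (\<lambda>w. wsum L' (\<lambda>v'. wsum L' (\<lambda>w'. g ((x + v - w) + v' - w')))))"
      unfolding wsum_conv
      by (subst (2) wsum_swap) (simp add: algebra_simps)
    also have "\<dots> \<le> \<epsilon> / 2"
      by (intro wsum_le L' L)
    finally show ?thesis
      using 1 by (simp add: wsum_add)
  qed
  then show "\<exists>L. is_weights L \<and> (\<forall>x. wsum L (\<lambda>v. wsum L (\<lambda>w. f (x + v - w) + g (x + v - w))) \<le> \<epsilon>)"
    using is_weights_conv[OF L(1) L'(1)] by blast
qed

lemma null_function_sum:
  assumes "finite I" and "\<And>i. i \<in> I \<Longrightarrow> null_function (f i)"
  shows "null_function (\<lambda>s. \<Sum>i\<in>I. f i s)"
  using assms
proof (induction I)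
  case empty
  have "is_weights [(1, 0)]"
    by (simp add: is_weights_def)
  then show ?case
    by (auto simp: null_function_def)
next
  case (insert i I)
  then show ?case
    by (simp add: null_function_add)
qed

text \<open>A new term has to meet finitely many conditions, one for each earlier term, each
  \<open>d\<close> and each \<open>g\<close>, and all of them put affine images of it into
  \<open>E\<close>; thickness meets them together.\<close>

lemma infinite_difference_sequence:
  fixes E :: "'a::idom set"
  assumes "thick E" and F: "finite F" "F \<subseteq> affine_semigroup" and D: "finite D"
  shows "\<exists>y :: nat \<Rightarrow> 'a. \<forall>j. \<forall>i<j. \<forall>d\<in>D. \<forall>g\<in>F. g (y j - y i + d) \<in> E"
proof (rule dependent_wellorder_choice)
  fix j and y :: "nat \<Rightarrow> 'a"
  define G where "G = (\<lambda>(g, i, d) x. g (x + (d - y i))) ` (F \<times> {..<j} \<times> D)"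
  have "G \<subseteq> affine_semigroup"
    unfolding G_def
  proof clarsimp
    fix g i d
    assume "g \<in> F"
    then show "(\<lambda>x. g (x + (d - y i))) \<in> affine_semigroup"
      using affine_semigroup_translate[of g "d - y i"] F(2) by blast
  qed
  moreover have "finite G"
    unfolding G_def using F(1) D by (intro finite_imageI finite_cartesian_product) auto
  ultimately obtain x where x: "\<forall>g\<in>G. g x \<in> E"
    using thickD[OF \<open>thick E\<close>] by metis
  have "g (x - y i + d) \<in> E" if "i < j" "d \<in> D" "g \<in> F" for i d g
  proof -
    have "(\<lambda>x. g (x + (d - y i))) \<in> G"
      unfolding G_def using that by (intro image_eqI[of _ _ "(g, i, d)"]) auto
    from bspec[OF x this] show ?thesis
      by (simp add: algebra_simps)
  qed
  then show "\<exists>x. \<forall>i<j. \<forall>d\<in>D. \<forall>g\<in>F. g (x - y i + d) \<in> E"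
    by blast
qed auto

text \<open>The point produced has the shape \<open>s - t + (v - w)\<close>: the pigeonhole principle on differences
  \<open>s - t\<close> moves into the thick set, and the differences \<open>v - w\<close> of one colour have positive proportion, which
  lets them meet the set where \<open>\<psi>\<close> is small.\<close>

lemma thick_recurrence:
  fixes E :: "'a::idom set"
  assumes E: "thick E" and F: "finite F" "F \<subseteq> affine_semigroup"
    and r: "finitely_colourable r" and \<psi>: "null_function \<psi>" and "\<theta> > 0"
  obtains s t v w where "\<forall>g\<in>F. g (s - t + (v - w)) \<in> E" and "r s t" and "r v w"
    and "\<psi> (s - t + (v - w)) \<le> \<theta>"
proof -
  obtain col :: "'a \<Rightarrow> nat" where col: "finite (range col)" "\<And>s t. col s = col t \<Longrightarrow> r s t"
    using r unfolding finitely_colourable_def by metis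
  define K where "K = real (card (range col))"
  have K: "K > 0"
    using col(1) by (simp add: K_def card_gt_0_iff)
  \<comment> \<open>Some colour has mass at least \<open>1 / K\<close>, so pairs of that colour have
    mass at least \<open>1 / K\<^sup>2\<close>. If \<open>\<psi>\<close> exceeded
    \<open>\<theta>\<close> on all of them, the average would be at least
    \<open>\<theta> / K\<^sup>2\<close>, twice the bound required here.\<close>
  have "\<theta> / (2 * K\<^sup>2) > 0"
    using K \<open>\<theta> > 0\<close> by simp
  then obtain L where L: "is_weights L"
      "\<And>x. wsum L (\<lambda>v. wsum L (\<lambda>w. \<psi> (x + v - w))) \<le> \<theta> / (2 * K\<^sup>2)"
    using \<psi> unfolding null_function_def by meson
  define D where "D = (\<lambda>(v, w). v - w) ` (snd ` set L \<times> snd ` set L)"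
  have "finite D"
    by (simp add: D_def)
  then obtain y :: "nat \<Rightarrow> 'a" where y: "\<forall>j. \<forall>i<j. \<forall>d\<in>D. \<forall>g\<in>F. g (y j - y i + d) \<in> E"
    using infinite_difference_sequence[OF E F] by blast
  have "\<not> inj (col \<circ> y)"
  proof
    assume "inj (col \<circ> y)"
    moreover have "finite (range (col \<circ> y))"
      by (rule finite_subset[OF _ col(1)]) auto
    ultimately show False
      using finite_imageD infinite_UNIV_nat by blast
  qed
  then obtain i j where ij: "i < j" "col (y j) = col (y i)"
    unfolding inj_def by (metis comp_apply linorder_less_linear)
  define x where "x = y j - y i"
  define mass where "mass c = wsum L (\<lambda>v. if col v = c then 1 else 0)" for c
  have "(\<Sum>c\<in>range col. mass c) = 1"
    unfolding mass_def using col(1) L(1) by (simp flip: wsum_sum add: wsum_const)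
  have "\<exists>c. mass c \<ge> 1 / K"
  proof (rule ccontr)
    assume "\<not> ?thesis"
    then have "(\<Sum>c\<in>range col. mass c) < (\<Sum>c\<in>range col. 1 / K)"
      using col(1) by (intro sum_strict_mono) (auto simp: not_le)
    also have "\<dots> = 1"
      using K by (simp add: K_def)
    finally show False
      using \<open>(\<Sum>c\<in>range col. mass c) = 1\<close> by simp
  qed
  then obtain c where c: "mass c \<ge> 1 / K"
    by blast
  have "\<exists>v\<in>snd ` set L. \<exists>w\<in>snd ` set L. col v = c \<and> col w = c \<and> \<psi> (x + v - w) \<le> \<theta>"
  proof (rule ccontr)
    assume neg: "\<not> ?thesis"
    have "0 \<le> mass c"
      using K by (intro order_trans[OF _ c]) simp
    then have "\<theta> * (1 / K * (1 / K)) \<le> \<theta> * (mass c * mass c)"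
      using c \<open>\<theta> > 0\<close> K by (intro mult_left_mono mult_mono) auto
    also have "\<dots> = wsum L (\<lambda>v. wsum L (\<lambda>w. \<theta> * ((if col v = c then 1 else 0) * (if col w = c then 1 else 0))))"
      unfolding mass_def wsum_product[symmetric] by (simp only: wsum_cmult)
    also have "\<dots> \<le> wsum L (\<lambda>v. wsum L (\<lambda>w. \<psi> (x + v - w)))"
    proof (intro wsum_mono[OF L(1)])
      fix v w
      assume "v \<in> snd ` set L" "w \<in> snd ` set L"
      moreover have "0 \<le> \<psi> (x + v - w)"
        using \<psi> unfolding null_function_def by blast
      ultimately show "\<theta> * ((if col v = c then 1 else 0) * (if col w = c then 1 else 0)) \<le> \<psi> (x + v - w)"
        using neg by (cases "col v = c \<and> col w = c") (auto simp: not_le intro: less_imp_le)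
    qed
    also have "\<dots> \<le> \<theta> / (2 * K\<^sup>2)"
      by (rule L)
    finally show False
      using K \<open>\<theta> > 0\<close> by (simp add: field_simps power2_eq_square)
  qed
  then obtain v w where vw: "v \<in> snd ` set L" "w \<in> snd ` set L" "col v = c" "col w = c"
      "\<psi> (x + v - w) \<le> \<theta>"
    by blast
  have "v - w \<in> D"
    using vw(1,2) unfolding D_def by blast
  then have "\<forall>g\<in>F. g (y j - y i + (v - w)) \<in> E"
    using y ij(1) by blast
  moreover have "\<psi> (y j - y i + (v - w)) \<le> \<theta>"
    using vw(5) by (simp add: x_def algebra_simps)
  ultimately show ?thesis
    using that[of "y j" "y i" v w] col(2) ij(2) vw(3,4) by auto
qed

section \<open>Semi-inner products and projections\<close>

text \<open>The discriminant criterion, stated on its own because it yields Cauchy-Schwarz for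
  vectors and for operators, the operator norm bound and the orthogonality of projections.\<close>

lemma quadratic_nonneg_imp:
  fixes a b c :: real
  assumes "\<And>t. 0 \<le> a + 2 * t * b + t\<^sup>2 * c"
  shows "b\<^sup>2 \<le> a * c"
proof (cases "c = 0")
  case True
  have "b = 0"
  proof (rule ccontr)
    assume "b \<noteq> 0"
    \<comment> \<open>At this \<open>t\<close> the quadratic, linear since \<open>c = 0\<close>,
      takes the value \<open>-1\<close>.\<close>
    then show False
      using assms[of "- (a + 1) / (2 * b)"] True by (simp add: field_simps)
  qed
  then show ?thesis
    using True by simp
next
  case False
  have "c \<ge> 0"
  proof (rule ccontr)
    assume "\<not> c \<ge> 0"
    then have c: "c < 0"
      by simp
    \<comment> \<open>Chosen to make \<open>2 * b + t * c\<close> at most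
      \<open>- 1 - \<bar>a\<bar>\<close>, while the final summand ensures that \<open>t\<close> is
      at least \<open>1\<close>.\<close>
    define t where "t = (1 + \<bar>a\<bar> + 2 * \<bar>b\<bar>) / (- c) + 1"
    have t: "t \<ge> 1"
      using c unfolding t_def by (simp add: field_simps)
    have "t * c = - (1 + \<bar>a\<bar> + 2 * \<bar>b\<bar>) + c"
      using c unfolding t_def by (simp add: field_simps)
    then have "2 * b + t * c \<le> - 1 - \<bar>a\<bar>"
      using c by linarith
    then have "t * (2 * b + t * c) \<le> t * (- 1 - \<bar>a\<bar>)"
      using t by (intro mult_left_mono) auto
    also have "\<dots> \<le> 1 * (- 1 - \<bar>a\<bar>)"
      using t by (intro mult_right_mono_neg) auto
    finally have "a + 2 * t * b + t\<^sup>2 * c < 0"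
      by (simp add: algebra_simps power2_eq_square)
    then show False
      using assms[of t] by simp
  qed
  with False have "c > 0"
    by simp
  moreover have "0 \<le> a + 2 * (- b / c) * b + (- b / c)\<^sup>2 * c"
    by (rule assms)
  ultimately show ?thesis
    by (simp add: field_simps power2_eq_square)
qed

text \<open>Nonzero vectors may have norm zero: the intended model consists of functions, not of
  classes modulo null sets.\<close>

locale semi_inner =
  fixes S :: "'v::real_vector set" and ip :: "'v \<Rightarrow> 'v \<Rightarrow> real"
  assumes subspace: "subspace S"
    and ip_add_left: "x \<in> S \<Longrightarrow> y \<in> S \<Longrightarrow> z \<in> S \<Longrightarrow> ip (x + y) z = ip x z + ip y z"
    and ip_scale_left: "x \<in> S \<Longrightarrow> y \<in> S \<Longrightarrow> ip (a *\<^sub>R x) y = a * ip x y"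
    and ip_commute: "ip x y = ip y x"
    and ip_nonneg: "x \<in> S \<Longrightarrow> 0 \<le> ip x x"
begin

lemmas S_zero [simp] = subspace_0[OF subspace]
lemmas S_add [simp] = subspace_add[OF subspace]
lemmas S_diff [simp] = subspace_diff[OF subspace]
lemmas S_neg [simp] = subspace_neg[OF subspace]
lemmas S_scale [simp] = subspace_scale[OF subspace]
lemmas S_sum = subspace_sum[OF subspace]

lemma ip_add_right: "x \<in> S \<Longrightarrow> y \<in> S \<Longrightarrow> z \<in> S \<Longrightarrow> ip z (x + y) = ip z x + ip z y"
  using ip_add_left ip_commute by metis

lemma ip_scale_right: "x \<in> S \<Longrightarrow> y \<in> S \<Longrightarrow> ip x (a *\<^sub>R y) = a * ip x y"
  using ip_scale_left ip_commute by metis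

lemma ip_diff_left: "x \<in> S \<Longrightarrow> y \<in> S \<Longrightarrow> z \<in> S \<Longrightarrow> ip (x - y) z = ip x z - ip y z"
  using ip_add_left[of x "(-1) *\<^sub>R y" z] ip_scale_left[of y z "-1"] S_scale[of y "-1"] by simp

lemma ip_diff_right: "x \<in> S \<Longrightarrow> y \<in> S \<Longrightarrow> z \<in> S \<Longrightarrow> ip z (x - y) = ip z x - ip z y"
  using ip_diff_left ip_commute by metis

lemma ip_zero_left [simp]: "x \<in> S \<Longrightarrow> ip 0 x = 0"
  using ip_scale_left[of 0 x 0] by simp

lemma ip_minus_minus [simp]: "x \<in> S \<Longrightarrow> y \<in> S \<Longrightarrow> ip (- x) (- y) = ip x y"
  using ip_scale_left[of x "- y" "-1"] ip_scale_right[of x y "-1"] by simp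

lemma ip_zero_right [simp]: "x \<in> S \<Longrightarrow> ip x 0 = 0"
  using ip_zero_left ip_commute by metis

lemmas ip_simps = ip_add_left ip_add_right ip_diff_left ip_diff_right ip_scale_left ip_scale_right

lemma ip_sum_left:
  "(\<And>i. i \<in> I \<Longrightarrow> x i \<in> S) \<Longrightarrow> y \<in> S \<Longrightarrow> ip (\<Sum>i\<in>I. x i) y = (\<Sum>i\<in>I. ip (x i) y)"
  by (induction I rule: infinite_finite_induct) (simp_all add: ip_add_left S_sum)

lemma ip_sum_right:
  "(\<And>i. i \<in> I \<Longrightarrow> x i \<in> S) \<Longrightarrow> y \<in> S \<Longrightarrow> ip y (\<Sum>i\<in>I. x i) = (\<Sum>i\<in>I. ip y (x i))"
  by (simp add: ip_commute[of y] ip_sum_left)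

definition nrm :: "'v \<Rightarrow> real" where
  "nrm x = sqrt (ip x x)"

lemma nrm_nonneg: "x \<in> S \<Longrightarrow> 0 \<le> nrm x"
  by (simp add: nrm_def ip_nonneg)

lemma nrm_sq: "x \<in> S \<Longrightarrow> (nrm x)\<^sup>2 = ip x x"
  by (simp add: nrm_def ip_nonneg)

lemma ip_sq_le:
  assumes "x \<in> S" "y \<in> S"
  shows "(ip x y)\<^sup>2 \<le> ip x x * ip y y"
proof (rule quadratic_nonneg_imp)
  fix t :: real
  have "0 \<le> ip (x + t *\<^sub>R y) (x + t *\<^sub>R y)"
    using assms by (simp add: ip_nonneg)
  also have "\<dots> = ip x x + 2 * t * ip x y + t\<^sup>2 * ip y y"
    using assms by (simp add: ip_simps ip_commute[of y x] power2_eq_square algebra_simps)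
  finally show "0 \<le> ip x x + 2 * t * ip x y + t\<^sup>2 * ip y y" .
qed

lemma cauchy_schwarz:
  assumes "x \<in> S" "y \<in> S"
  shows "\<bar>ip x y\<bar> \<le> nrm x * nrm y"
proof -
  have "(ip x y)\<^sup>2 \<le> (nrm x * nrm y)\<^sup>2"
    using ip_sq_le[OF assms] assms by (simp add: power_mult_distrib nrm_sq)
  then show ?thesis
    using abs_le_square_iff nrm_nonneg assms by (metis abs_of_nonneg mult_nonneg_nonneg)
qed

lemma nrm_triangle:
  assumes "x \<in> S" "y \<in> S"
  shows "nrm (x + y) \<le> nrm x + nrm y"
proof (rule power2_le_imp_le)
  have "(nrm (x + y))\<^sup>2 = ip x x + 2 * ip x y + ip y y"
    using assms by (simp add: nrm_sq ip_simps ip_commute[of y x])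
  also have "\<dots> \<le> (nrm x)\<^sup>2 + 2 * (nrm x * nrm y) + (nrm y)\<^sup>2"
    using cauchy_schwarz[OF assms] assms by (simp add: nrm_sq)
  finally show "(nrm (x + y))\<^sup>2 \<le> (nrm x + nrm y)\<^sup>2"
    by (simp add: power2_sum)
  show "0 \<le> nrm x + nrm y"
    using assms nrm_nonneg by simp
qed

lemma nrm_scale: "x \<in> S \<Longrightarrow> nrm (a *\<^sub>R x) = \<bar>a\<bar> * nrm x"
  by (simp add: nrm_def ip_simps real_sqrt_mult flip: mult.assoc)

lemma nrm_minus [simp]: "x \<in> S \<Longrightarrow> nrm (- x) = nrm x"
  by (simp add: nrm_def)

lemma nrm_minus_commute: "x \<in> S \<Longrightarrow> y \<in> S \<Longrightarrow> nrm (x - y) = nrm (y - x)"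
  using nrm_scale[of "x - y" "-1"] by simp

lemma nrm_zero [simp]: "nrm 0 = 0"
  by (simp add: nrm_def)

lemma nrm_le_sqrt: "ip x x \<le> a \<Longrightarrow> nrm x \<le> sqrt a"
  by (simp add: nrm_def)

lemma nrm_tendsto_zero: "(\<lambda>n. ip (X n) (X n)) \<longlonglongrightarrow> 0 \<Longrightarrow> (\<lambda>n. nrm (X n)) \<longlonglongrightarrow> 0"
  using tendsto_real_sqrt[of _ 0] by (simp add: nrm_def)

lemma tendsto_ip:
  assumes "\<And>n. X n \<in> S" "l \<in> S" "z \<in> S" "(\<lambda>n. nrm (X n - l)) \<longlonglongrightarrow> 0"
  shows "(\<lambda>n. ip (X n) z) \<longlonglongrightarrow> ip l z"
proof (rule LIM_zero_cancel, rule Lim_null_comparison)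
  show "\<forall>\<^sub>F n in sequentially. norm (ip (X n) z - ip l z) \<le> nrm (X n - l) * nrm z"
    using cauchy_schwarz[of "X _ - l" z] assms by (auto simp: ip_diff_left)
  show "(\<lambda>n. nrm (X n - l) * nrm z) \<longlonglongrightarrow> 0"
    using tendsto_mult_left_zero[OF assms(4)] .
qed

end

text \<open>Condition \<open>schur\<close> says that a sum of tensors \<open>x \<otimes> y\<close>
  has nonnegative squared norm in the tensor square; positivity of \<open>hs\<close> comes from it.
  Limits as in \<open>complete\<close> are determined only up to vectors of norm zero.\<close>

locale semi_hilbert = semi_inner S ip
  for S :: "'v::real_vector set" and ip :: "'v \<Rightarrow> 'v \<Rightarrow> real" +
  assumes schur: "set P \<subseteq> S \<times> S \<Longrightarrow>
      0 \<le> (\<Sum>p\<leftarrow>P. \<Sum>q\<leftarrow>P. ip (fst p) (fst q) * ip (snd p) (snd q))"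
    and complete: "(\<And>n. X n \<in> S) \<Longrightarrow>
      (\<And>e. e > 0 \<Longrightarrow> \<exists>N. \<forall>m\<ge>N. \<forall>n\<ge>N. ip (X m - X n) (X m - X n) < e) \<Longrightarrow>
      \<exists>l\<in>S. (\<lambda>n. ip (X n - l) (X n - l)) \<longlonglongrightarrow> 0"
begin

text \<open>A minimizing sequence in \<open>C\<close> is Cauchy by the parallelogram law, and at its
  limit the first variation of the distance vanishes along \<open>C\<close>. The closedness
  assumption speaks of every limit in \<open>S\<close>, as limits are not unique.\<close>

lemma projection:
  assumes C: "subspace C" "C \<subseteq> S" and f: "f \<in> S"
    and closed: "\<And>X l. (\<And>n. X n \<in> C) \<Longrightarrow> l \<in> S \<Longrightarrow> (\<lambda>n. nrm (X n - l)) \<longlonglongrightarrow> 0 \<Longrightarrow> l \<in> C"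
  shows "\<exists>g\<in>C. \<forall>w\<in>C. ip (f - g) w = 0"
proof -
  define D where "D = (\<lambda>w. ip (f - w) (f - w)) ` C"
  define d where "d = Inf D"
  have CS: "w \<in> S" if "w \<in> C" for w
    using that C by blast
  have bdd: "bdd_below D"
    unfolding D_def using f CS by (auto intro!: bdd_belowI[of _ 0] ip_nonneg)
  have ne: "D \<noteq> {}"
    using subspace_0[OF C(1)] by (auto simp: D_def)
  have d_le: "d \<le> ip (f - w) (f - w)" if "w \<in> C" for w
    unfolding d_def using that bdd by (auto intro!: cInf_lower simp: D_def)
  have "\<exists>w\<in>C. ip (f - w) (f - w) < d + inverse (real (Suc n))" for n
    using cInf_lessD[OF ne, of "d + inverse (real (Suc n))"] by (auto simp: d_def D_def)
  then obtain X where X: "\<And>n. X n \<in> C" "\<And>n. ip (f - X n) (f - X n) < d + inverse (real (Suc n))"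
    by metis
  have XS: "X n \<in> S" for n
    using X CS by blast
  have close: "ip (X m - X n) (X m - X n) \<le> 2 * inverse (real (Suc m)) + 2 * inverse (real (Suc n))" for m n
  proof -
    \<comment> \<open>The midpoint is a competitor in \<open>C\<close>, so its squared distance from
      \<open>f\<close> is at least \<open>d\<close>.\<close>
    have "(1/2) *\<^sub>R (X m + X n) \<in> C"
      using X C by (simp add: subspace_add subspace_scale)
    from d_le[OF this] have "4 * d \<le> 4 * ip f f - 4 * ip f (X m) - 4 * ip f (X n)
        + ip (X m) (X m) + 2 * ip (X m) (X n) + ip (X n) (X n)"
      using f XS
      by (simp add: ip_simps ip_commute[of "X _" f] ip_commute[of "X n" "X m"] field_simps)
    then show ?thesis
      using X(2)[of m] X(2)[of n] f XS
      by (simp add: ip_simps ip_commute[of "X _" f] ip_commute[of "X n" "X m"])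
  qed
  have "\<exists>l\<in>S. (\<lambda>n. ip (X n - l) (X n - l)) \<longlonglongrightarrow> 0"
  proof (rule complete)
    fix e :: real
    assume "e > 0"
    then obtain N where N: "inverse (real (Suc N)) < e / 4"
      using reals_Archimedean[of "e / 4"] by auto
    have inv: "inverse (real (Suc m)) \<le> inverse (real (Suc N))" if "m \<ge> N" for m
      using that by (simp add: field_simps)
    have "ip (X m - X n) (X m - X n) < e" if "m \<ge> N" "n \<ge> N" for m n
      using close[of m n] N inv[OF that(1)] inv[OF that(2)] by linarith
    then show "\<exists>N. \<forall>m\<ge>N. \<forall>n\<ge>N. ip (X m - X n) (X m - X n) < e"
      by blast
  qed (rule XS)
  then obtain l where l: "l \<in> S" "(\<lambda>n. nrm (X n - l)) \<longlonglongrightarrow> 0"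
    by (auto dest: nrm_tendsto_zero)
  have lC: "l \<in> C"
    using closed[OF X(1) l] .
  have "nrm (f - l) \<le> sqrt d"
  proof (rule LIMSEQ_le_const)
    have "(\<lambda>n. d + inverse (real (Suc n))) \<longlonglongrightarrow> d + 0"
      by (intro tendsto_add tendsto_const LIMSEQ_inverse_real_of_nat)
    then have "(\<lambda>n. sqrt (d + inverse (real (Suc n))) + nrm (X n - l)) \<longlonglongrightarrow> sqrt d + 0"
      using tendsto_add[OF tendsto_real_sqrt l(2)] by fastforce
    then show "(\<lambda>n. sqrt (d + inverse (real (Suc n))) + nrm (X n - l)) \<longlonglongrightarrow> sqrt d"
      by simp
    have "nrm (f - l) \<le> sqrt (d + inverse (real (Suc n))) + nrm (X n - l)" for n
    proof -
      have "nrm (f - l) \<le> nrm (f - X n) + nrm (X n - l)"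
        using nrm_triangle[of "f - X n" "X n - l"] f XS l by simp
      also have "nrm (f - X n) \<le> sqrt (d + inverse (real (Suc n)))"
        using X(2)[of n] by (intro nrm_le_sqrt) simp
      finally show ?thesis
        by simp
    qed
    then show "\<exists>N. \<forall>n\<ge>N. nrm (f - l) \<le> sqrt (d + inverse (real (Suc n))) + nrm (X n - l)"
      by blast
  qed
  then have fl: "ip (f - l) (f - l) \<le> d"
    by (simp add: nrm_def)
  have "ip (f - l) w = 0" if w: "w \<in> C" for w
  proof -
    \<comment> \<open>Minimality at \<open>l\<close> makes the quadratic with constant term
      \<open>0\<close> nonnegative, so the discriminant bound is zero.\<close>
    have "(ip (f - l) w)\<^sup>2 \<le> 0 * ip w w"
    proof (rule quadratic_nonneg_imp)
      fix t :: real
      have "l - t *\<^sub>R w \<in> C"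
        using lC w C by (simp add: subspace_diff subspace_scale)
      define v where "v = f - l"
      have v: "v \<in> S" "f - (l - t *\<^sub>R w) = v + t *\<^sub>R w"
        using f l(1) by (simp_all add: v_def)
      have "d \<le> ip (v + t *\<^sub>R w) (v + t *\<^sub>R w)"
        using d_le[OF \<open>l - t *\<^sub>R w \<in> C\<close>] unfolding v(2) .
      also have "\<dots> = ip v v + 2 * t * ip v w + t\<^sup>2 * ip w w"
        using CS[OF w] v(1)
        by (simp add: ip_simps ip_commute[of w v] power2_eq_square algebra_simps)
      finally show "0 \<le> 0 + 2 * t * ip (f - l) w + t\<^sup>2 * ip w w"
        using fl by (simp add: v_def)
    qed
    then show ?thesis
      by simp
  qed
  then show ?thesis
    using lC by blast
qed

text \<open>A list of pairs \<open>(a, x)\<close> stands for the operator \<open>\<Sum> a x \<otimes> x\<close>; \<open>hs\<close> is the Hilbert-Schmidt inner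
  product of two such operators.\<close>

definition hs :: "(real \<times> 'v) list \<Rightarrow> (real \<times> 'v) list \<Rightarrow> real" where
  "hs L L' = wsum L (\<lambda>x. wsum L' (\<lambda>y. (ip x y)\<^sup>2))"

definition rank1_sum :: "(real \<times> 'v) list \<Rightarrow> 'v \<Rightarrow> 'v" where
  "rank1_sum L z = (\<Sum>p\<leftarrow>L. (fst p * ip (snd p) z) *\<^sub>R snd p)"

lemma rank1_sum_simps [simp]:
  "rank1_sum [] z = 0"
  "rank1_sum (p # L) z = (fst p * ip (snd p) z) *\<^sub>R snd p + rank1_sum L z"
  "rank1_sum (L @ L') z = rank1_sum L z + rank1_sum L' z"
  by (simp_all add: rank1_sum_def)

lemma rank1_sum_in [simp]: "snd ` set L \<subseteq> S \<Longrightarrow> rank1_sum L z \<in> S"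
  by (induction L) auto

lemma ip_rank1_sum:
  "snd ` set L \<subseteq> S \<Longrightarrow> y \<in> S \<Longrightarrow> ip (rank1_sum L z) y = wsum L (\<lambda>x. ip x z * ip x y)"
  by (induction L) (auto simp: ip_simps algebra_simps)

lemma hs_commute: "hs L L' = hs L' L"
  unfolding hs_def by (subst wsum_swap) (simp add: ip_commute)

lemma hs_append_left: "hs (L @ L') K = hs L K + hs L' K"
  by (simp add: hs_def)

lemma hs_append_right: "hs K (L @ L') = hs K L + hs K L'"
  using hs_append_left hs_commute by metis

lemma hs_scale_left: "hs (map (apfst ((*) c)) L) K = c * hs L K"
  by (simp add: hs_def wsum_scale)

lemma hs_scale_right: "hs K (map (apfst ((*) c)) L) = c * hs K L"
  using hs_scale_left hs_commute by metis

text \<open>The tensor \<open>a x \<otimes> x\<close> is encoded as the pair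
  \<open>(a x, x)\<close>; in this way signed weights pass into the condition
  \<open>schur\<close>.\<close>

lemma schur_sum:
  assumes "snd ` set L \<subseteq> S" "snd ` set L' \<subseteq> S"
  shows "(\<Sum>p\<leftarrow>map (\<lambda>p. (fst p *\<^sub>R snd p, snd p)) L. \<Sum>q\<leftarrow>map (\<lambda>p. (fst p *\<^sub>R snd p, snd p)) L'.
      ip (fst p) (fst q) * ip (snd p) (snd q)) = hs L L'"
proof -
  have 1: "(\<Sum>q\<leftarrow>map (\<lambda>p. (fst p *\<^sub>R snd p, snd p)) L'. ip (a *\<^sub>R x) (fst q) * ip x (snd q))
      = a * wsum L' (\<lambda>y. (ip x y)\<^sup>2)" if "x \<in> S" for a x
    using assms(2) that
    by (induction L') (auto simp: ip_simps algebra_simps power2_eq_square)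
  show ?thesis
    using assms(1) by (induction L) (auto simp: hs_def 1 simp del: map_map)
qed

lemma hs_nonneg:
  assumes "snd ` set L \<subseteq> S"
  shows "0 \<le> hs L L"
proof -
  have "set (map (\<lambda>p. (fst p *\<^sub>R snd p, snd p)) L) \<subseteq> S \<times> S"
    using assms by auto
  from schur[OF this] show ?thesis
    using schur_sum[OF assms assms] by simp
qed

lemma hs_cauchy_schwarz:
  assumes "snd ` set L \<subseteq> S" "snd ` set L' \<subseteq> S"
  shows "(hs L L')\<^sup>2 \<le> hs L L * hs L' L'"
proof (rule quadratic_nonneg_imp)
  fix t :: real
  have "0 \<le> hs (L @ map (apfst ((*) t)) L') (L @ map (apfst ((*) t)) L')"
    using assms by (intro hs_nonneg) auto
  also have "\<dots> = hs L L + 2 * t * hs L L' + t\<^sup>2 * hs L' L'"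
    by (simp add: hs_append_left hs_append_right hs_scale_left hs_scale_right hs_commute[of L' L]
        power2_eq_square algebra_simps)
  finally show "0 \<le> hs L L + 2 * t * hs L L' + t\<^sup>2 * hs L' L'" .
qed

text \<open>The operator norm is at most the Hilbert-Schmidt norm. For \<open>y = K z\<close>,
  \<open>ip y y\<close> is the Hilbert-Schmidt product of \<open>K\<close> and
  \<open>y \<otimes> z\<close>; nonnegativity of the squared norm of
  \<open>K + t (y \<otimes> z)\<close> for all \<open>t\<close> bounds its square, and one factor
  \<open>ip y y\<close> cancels.\<close>

lemma rank1_sum_bound:
  assumes L: "snd ` set L \<subseteq> S" and z: "z \<in> S"
  shows "ip (rank1_sum L z) (rank1_sum L z) \<le> hs L L * ip z z"
proof -
  let ?y = "rank1_sum L z"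
  let ?m = "map (\<lambda>p. (fst p *\<^sub>R snd p, snd p))"
  have y: "?y \<in> S"
    using L by simp
  have "(ip ?y ?y)\<^sup>2 \<le> hs L L * (ip ?y ?y * ip z z)"
  proof (rule quadratic_nonneg_imp)
    fix t :: real
    let ?P = "?m L @ [(t *\<^sub>R ?y, z)]"
    have 1: "(\<Sum>p\<leftarrow>?m L. ip (fst p) (t *\<^sub>R y) * ip (snd p) z) = t * wsum L (\<lambda>x. ip x z * ip x y)"
      if "y \<in> S" for y
      using L that z by (induction L) (auto simp: ip_simps algebra_simps)
    have 2: "(\<Sum>p\<leftarrow>?m L. ip (t *\<^sub>R y) (fst p) * ip z (snd p)) = t * wsum L (\<lambda>x. ip x z * ip x y)"
      if "y \<in> S" for y
      using 1[OF that] by (simp add: ip_commute)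
    have "set ?P \<subseteq> S \<times> S"
      using L y z by auto
    from schur[OF this] have "0 \<le> (\<Sum>p\<leftarrow>?m L. \<Sum>q\<leftarrow>?m L. ip (fst p) (fst q) * ip (snd p) (snd q))
        + (\<Sum>p\<leftarrow>?m L. ip (fst p) (t *\<^sub>R ?y) * ip (snd p) z)
        + (\<Sum>p\<leftarrow>?m L. ip (t *\<^sub>R ?y) (fst p) * ip z (snd p))
        + ip (t *\<^sub>R ?y) (t *\<^sub>R ?y) * ip z z"
      by (simp add: sum_list_addf del: map_map)
    also have "\<dots> = hs L L + 2 * t * ip ?y ?y + t\<^sup>2 * (ip ?y ?y * ip z z)"
      unfolding schur_sum[OF L L] 1[OF y] 2[OF y] ip_rank1_sum[OF L y, symmetric]
      using y by (simp add: ip_simps power2_eq_square)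
    finally show "0 \<le> hs L L + 2 * t * ip ?y ?y + t\<^sup>2 * (ip ?y ?y * ip z z)" .
  qed
  then have "ip ?y ?y * ip ?y ?y \<le> (hs L L * ip z z) * ip ?y ?y"
    by (simp add: power2_eq_square mult_ac)
  \<comment> \<open>Covers the case in which \<open>ip ?y ?y\<close> is zero and cannot be
    cancelled.\<close>
  moreover have "0 \<le> hs L L * ip z z"
    using hs_nonneg[OF L] ip_nonneg[OF z] by simp
  ultimately show ?thesis
    using ip_nonneg[OF y] by (metis le_less mult_le_cancel_right not_le)
qed

lemma rank1_sum_diff:
  "rank1_sum L z - rank1_sum L' z = rank1_sum (L @ map (apfst ((*) (- 1))) L') z"
proof -
  have "rank1_sum (map (apfst ((*) (- 1))) L') z = - rank1_sum L' z"
    by (induction L') simp_all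
  then show ?thesis
    by simp
qed

lemma rank1_sum_diff_bound:
  assumes "snd ` set L \<subseteq> S" "snd ` set L' \<subseteq> S" "z \<in> S"
  shows "ip (rank1_sum L z - rank1_sum L' z) (rank1_sum L z - rank1_sum L' z)
    \<le> (hs L L - 2 * hs L L' + hs L' L') * ip z z"
proof -
  let ?K = "L @ map (apfst ((*) (- 1))) L'"
  have "snd ` set ?K \<subseteq> S"
    using assms by auto
  from rank1_sum_bound[OF this assms(3)] show ?thesis
    unfolding rank1_sum_diff
    by (simp del: rank1_sum_simps add: hs_append_left hs_append_right hs_scale_left hs_scale_right hs_commute[of L' L]
        algebra_simps)
qed

lemma rank1_sum_minus_arg:
  assumes "snd ` set L \<subseteq> S" "y \<in> S" "z \<in> S"
  shows "rank1_sum L y - rank1_sum L z = rank1_sum L (y - z)"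
  using assms by (induction L) (auto simp: ip_simps algebra_simps)

lemma nrm_rank1_sum_le:
  assumes "snd ` set L \<subseteq> S" "\<And>p. p \<in> set L \<Longrightarrow> 0 \<le> fst p"
  shows "nrm (rank1_sum L z) \<le> wsum L (\<lambda>x. \<bar>ip x z\<bar> * nrm x)"
  using assms
proof (induction L)
  case (Cons p L)
  have "nrm (rank1_sum (p # L) z) \<le> nrm ((fst p * ip (snd p) z) *\<^sub>R snd p) + nrm (rank1_sum L z)"
    unfolding rank1_sum_simps using Cons.prems by (intro nrm_triangle) auto
  also have "nrm ((fst p * ip (snd p) z) *\<^sub>R snd p) = fst p * (\<bar>ip (snd p) z\<bar> * nrm (snd p))"
    using Cons.prems by (simp add: nrm_scale abs_mult)
  finally show ?case
    using Cons by simp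
qed simp

end

section \<open>Almost periodic vectors of an additive action\<close>

locale additive_rep = semi_hilbert S ip
  for S :: "'v::real_vector set" and ip :: "'v \<Rightarrow> 'v \<Rightarrow> real" +
  fixes A :: "'a::large_ideal_domain \<Rightarrow> 'v \<Rightarrow> 'v"
  assumes A_in [simp]: "x \<in> S \<Longrightarrow> A v x \<in> S"
    and A_add: "x \<in> S \<Longrightarrow> y \<in> S \<Longrightarrow> A v (x + y) = A v x + A v y"
    and A_scale: "x \<in> S \<Longrightarrow> A v (a *\<^sub>R x) = a *\<^sub>R A v x"
    and A_ip [simp]: "x \<in> S \<Longrightarrow> y \<in> S \<Longrightarrow> ip (A v x) (A v y) = ip x y"
    and A_A [simp]: "x \<in> S \<Longrightarrow> A v (A w x) = A (v + w) x"
    and A_0 [simp]: "x \<in> S \<Longrightarrow> A 0 x = x"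
begin

lemma A_diff: "x \<in> S \<Longrightarrow> y \<in> S \<Longrightarrow> A v (x - y) = A v x - A v y"
  using A_add[of x "(-1) *\<^sub>R y" v] A_scale[of y v "-1"] S_scale[of y "-1"] by simp

lemma A_zero [simp]: "A v 0 = 0"
  using A_scale[of 0 v 0] by simp

lemma nrm_A [simp]: "x \<in> S \<Longrightarrow> nrm (A v x) = nrm x"
  by (simp add: nrm_def)

lemma ip_A_A:
  assumes "x \<in> S" "y \<in> S"
  shows "ip (A (v + w) x) y = ip (A v x) (A (- w) y)"
  using A_ip[of "A (v + w) x" y "- w"] assms by simp

lemma nrm_A_diff:
  assumes "x \<in> S"
  shows "nrm (A s x - A t x) = nrm (A (s - t) x - x)"
proof -
  have "A t (A (s - t) x - x) = A s x - A t x"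
    using assms by (simp add: A_diff)
  then show ?thesis
    using nrm_A[of "A (s - t) x - x" t] assms by simp
qed

text \<open>A vector is almost periodic iff its orbit is totally bounded. Finite colourings replace finite
  nets since they can be intersected over several vectors, multipliers and systems.\<close>

definition almost_periodic :: "'v set" where
  "almost_periodic =
     {x \<in> S. \<forall>\<eta>>0. finitely_colourable (\<lambda>s t. nrm (A s x - A t x) \<le> \<eta>)}"

lemma almost_periodic_in: "x \<in> almost_periodic \<Longrightarrow> x \<in> S"
  by (simp add: almost_periodic_def)

lemma finitely_colourable_almost_periodic:
  "x \<in> almost_periodic \<Longrightarrow> \<eta> > 0 \<Longrightarrow> finitely_colourable (\<lambda>s t. nrm (A s x - A t x) \<le> \<eta>)"
  by (simp add: almost_periodic_def)

lemma invariant_almost_periodic: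
  assumes "x \<in> S" and "\<And>s. A s x = x"
  shows "x \<in> almost_periodic"
proof -
  have "finitely_colourable (\<lambda>s t :: 'a. True)"
    by (rule finitely_colourableI[of "\<lambda>_. ()"]) auto
  then show ?thesis
    using assms by (simp add: almost_periodic_def finitely_colourable_mono)
qed

lemma subspace_almost_periodic: "subspace almost_periodic"
proof (rule subspaceI)
  show "0 \<in> almost_periodic"
    by (rule invariant_almost_periodic) auto
next
  fix x y
  assume xy: "x \<in> almost_periodic" "y \<in> almost_periodic"
  have S: "x \<in> S" "y \<in> S"
    using xy almost_periodic_in by auto
  have "finitely_colourable (\<lambda>s t. nrm (A s (x + y) - A t (x + y)) \<le> \<eta>)" if "\<eta> > 0" for \<eta>
  proof -
    have "finitely_colourable (\<lambda>s t. nrm (A s x - A t x) \<le> \<eta> / 2 \<and> nrm (A s y - A t y) \<le> \<eta> / 2)"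
      by (intro finitely_colourable_conj finitely_colourable_almost_periodic xy) (use that in auto)
    then show ?thesis
    proof (rule finitely_colourable_mono)
      fix s t
      assume *: "nrm (A s x - A t x) \<le> \<eta> / 2 \<and> nrm (A s y - A t y) \<le> \<eta> / 2"
      have "A s (x + y) - A t (x + y) = (A s x - A t x) + (A s y - A t y)"
        using S by (simp add: A_add)
      then have "nrm (A s (x + y) - A t (x + y)) \<le> nrm (A s x - A t x) + nrm (A s y - A t y)"
        using nrm_triangle[of "A s x - A t x" "A s y - A t y"] S by simp
      then show "nrm (A s (x + y) - A t (x + y)) \<le> \<eta>"
        using * by simp
    qed
  qed
  then show "x + y \<in> almost_periodic"
    using S by (simp add: almost_periodic_def)
next
  fix x and c :: real
  assume x: "x \<in> almost_periodic"
  have S: "x \<in> S"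
    using x almost_periodic_in by auto
  have "finitely_colourable (\<lambda>s t. nrm (A s (c *\<^sub>R x) - A t (c *\<^sub>R x)) \<le> \<eta>)" if "\<eta> > 0" for \<eta>
  proof -
    have "finitely_colourable (\<lambda>s t. nrm (A s x - A t x) \<le> \<eta> / (\<bar>c\<bar> + 1))"
      by (intro finitely_colourable_almost_periodic x) (use that in auto)
    then show ?thesis
    proof (rule finitely_colourable_mono)
      fix s t
      assume *: "nrm (A s x - A t x) \<le> \<eta> / (\<bar>c\<bar> + 1)"
      have "nrm (A s (c *\<^sub>R x) - A t (c *\<^sub>R x)) = \<bar>c\<bar> * nrm (A s x - A t x)"
        using S by (simp add: A_scale nrm_scale flip: scaleR_diff_right)
      also have "\<dots> \<le> \<bar>c\<bar> * (\<eta> / (\<bar>c\<bar> + 1))"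
        using * by (intro mult_left_mono) auto
      also have "\<dots> \<le> \<eta>"
        using that by (simp add: field_simps)
      finally show "nrm (A s (c *\<^sub>R x) - A t (c *\<^sub>R x)) \<le> \<eta>" .
    qed
  qed
  then show "c *\<^sub>R x \<in> almost_periodic"
    using S by (simp add: almost_periodic_def)
qed

lemma nrm_orbit_diff_le:
  assumes "x \<in> S" "y \<in> S"
  shows "nrm (A s x - A t x) \<le> 2 * nrm (x - y) + nrm (A s y - A t y)"
proof -
  have "A s x - A t x = (A s (x - y) + A t (y - x)) + (A s y - A t y)"
    using assms by (simp add: A_diff)
  also have "nrm \<dots> \<le> nrm (A s (x - y) + A t (y - x)) + nrm (A s y - A t y)"
    using assms by (intro nrm_triangle) auto
  also have "nrm (A s (x - y) + A t (y - x)) \<le> nrm (A s (x - y)) + nrm (A t (y - x))"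
    using assms by (intro nrm_triangle) auto
  finally show ?thesis
    using assms by (simp add: nrm_minus_commute[of y x])
qed

lemma almost_periodic_closed:
  assumes X: "\<And>n. X n \<in> almost_periodic" and l: "l \<in> S" "(\<lambda>n. nrm (X n - l)) \<longlonglongrightarrow> 0"
  shows "l \<in> almost_periodic"
proof -
  have "finitely_colourable (\<lambda>s t. nrm (A s l - A t l) \<le> \<eta>)" if "\<eta> > 0" for \<eta>
  proof -
    have "\<forall>\<^sub>F n in sequentially. nrm (X n - l) < \<eta> / 4"
      using l(2) that by (intro order_tendstoD) auto
    then obtain n where n: "nrm (X n - l) < \<eta> / 4"
      using eventually_sequentially by auto
    have XS: "X n \<in> S"
      using X almost_periodic_in by auto
    have "finitely_colourable (\<lambda>s t. nrm (A s (X n) - A t (X n)) \<le> \<eta> / 2)"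
      by (intro finitely_colourable_almost_periodic X) (use that in auto)
    then show ?thesis
    proof (rule finitely_colourable_mono)
      fix s t
      assume "nrm (A s (X n) - A t (X n)) \<le> \<eta> / 2"
      then show "nrm (A s l - A t l) \<le> \<eta>"
        using nrm_orbit_diff_le[OF l(1) XS, of s t] n nrm_minus_commute[OF l(1) XS] by simp
    qed
  qed
  then show ?thesis
    using l by (simp add: almost_periodic_def)
qed

text \<open>The orthogonal projection, unique only up to a vector of norm zero; the arguments below
  use only membership and orthogonality.\<close>

definition ap_part :: "'v \<Rightarrow> 'v" where
  "ap_part f = (SOME g. g \<in> almost_periodic \<and> (\<forall>w\<in>almost_periodic. ip (f - g) w = 0))"

lemma
  assumes "f \<in> S"
  shows ap_part_almost_periodic: "ap_part f \<in> almost_periodic"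
    and ip_ap_part: "w \<in> almost_periodic \<Longrightarrow> ip (f - ap_part f) w = 0"
proof -
  have "\<exists>g\<in>almost_periodic. \<forall>w\<in>almost_periodic. ip (f - g) w = 0"
  proof (rule projection[OF subspace_almost_periodic _ assms])
    show "almost_periodic \<subseteq> S"
      using almost_periodic_in by blast
  qed (rule almost_periodic_closed)
  then have "\<exists>g. g \<in> almost_periodic \<and> (\<forall>w\<in>almost_periodic. ip (f - g) w = 0)"
    by blast
  from someI_ex[OF this] show "ap_part f \<in> almost_periodic"
    and "w \<in> almost_periodic \<Longrightarrow> ip (f - ap_part f) w = 0"
    unfolding ap_part_def by auto
qed

lemma ap_part_in [simp]: "f \<in> S \<Longrightarrow> ap_part f \<in> S"
  using ap_part_almost_periodic almost_periodic_in by blast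

lemma nrm_pythagoras:
  assumes "f \<in> S"
  shows "(nrm f)\<^sup>2 = (nrm (ap_part f))\<^sup>2 + (nrm (f - ap_part f))\<^sup>2"
proof -
  have "ip (f - ap_part f) (ap_part f) = 0"
    using ip_ap_part[OF assms ap_part_almost_periodic[OF assms]] .
  then show ?thesis
    using assms by (simp add: nrm_sq ip_simps ip_commute[of "ap_part f" f])
qed

lemma
  assumes "f \<in> S"
  shows nrm_ap_part_le: "nrm (ap_part f) \<le> nrm f"
    and nrm_weakly_mixing_part_le: "nrm (f - ap_part f) \<le> nrm f"
  by (rule power2_le_imp_le; use nrm_pythagoras[OF assms] nrm_nonneg[OF assms] in simp)+

text \<open>As an operator, the average of \<open>A_(cv) h \<otimes> A_(cv) h\<close> under the
  weights \<open>L\<close>. The factor \<open>c\<close> restricts the translations to multiples of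
  \<open>c\<close>, along which the later shifts run.\<close>

definition orbit :: "'a \<Rightarrow> 'v \<Rightarrow> (real \<times> 'a) list \<Rightarrow> (real \<times> 'v) list" where
  "orbit c h L = map (apsnd (\<lambda>v. A (c * v) h)) L"

lemma orbit_in: "h \<in> S \<Longrightarrow> snd ` set (orbit c h L) \<subseteq> S"
  by (auto simp: orbit_def)

lemma orbit_nonneg: "is_weights L \<Longrightarrow> p \<in> set (orbit c h L) \<Longrightarrow> 0 \<le> fst p"
  by (auto simp: orbit_def is_weights_def)

lemma wsum_orbit: "wsum (orbit c h L) f = wsum L (\<lambda>v. f (A (c * v) h))"
  by (simp add: orbit_def wsum_map)

definition shift :: "'a \<Rightarrow> (real \<times> 'a) list \<Rightarrow> (real \<times> 'a) list" where
  "shift s L = map (apsnd ((+) s)) L"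

lemma is_weights_shift: "is_weights L \<Longrightarrow> is_weights (shift s L)"
  by (auto simp: is_weights_def shift_def o_def)

lemma hs_shift: "h \<in> S \<Longrightarrow> hs (orbit c h (shift s L)) (orbit c h (shift s L')) = hs (orbit c h L) (orbit c h L')"
  unfolding hs_def wsum_orbit unfolding shift_def wsum_map
  using A_ip[of "A (c * _) h" "A (c * _) h" "c * s"] by (simp add: algebra_simps)

text \<open>Shifting the weights by \<open>s\<close> conjugates the averaged operator by
  \<open>A_(cs)\<close>.\<close>

lemma rank1_sum_shift:
  assumes "h \<in> S" "z \<in> S"
  shows "rank1_sum (orbit c h (shift s L)) (A (c * s) z) = A (c * s) (rank1_sum (orbit c h L) z)"
proof (induction L)
  case (Cons p L)
  have "A (c * (s + snd p)) h = A (c * s) (A (c * snd p) h)"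
    using assms by (simp add: algebra_simps)
  then show ?case
    using Cons assms orbit_in[OF assms(1), of c L]
    by (simp add: orbit_def shift_def A_add A_scale del: A_A)
qed (simp add: orbit_def shift_def)

text \<open>The midpoint of two averages, so that the operators \<open>orbit c h L\<close> with
  weights \<open>L\<close> behave as a convex set in the minimization of the Hilbert-Schmidt
  norm.\<close>

definition mix :: "(real \<times> 'a) list \<Rightarrow> (real \<times> 'a) list \<Rightarrow> (real \<times> 'a) list" where
  "mix L L' = map (apfst ((*) (1 / 2))) (L @ L')"

lemma is_weights_mix:
  assumes "is_weights L" "is_weights L'"
  shows "is_weights (mix L L')"
proof -
  have sum_fst: "(\<Sum>p\<leftarrow>L. fst p) = wsum L (\<lambda>_. 1)" for L :: "(real \<times> 'a) list"
    by (simp add: wsum_def)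
  show ?thesis
    using assms wsum_const[OF assms(1), of 1] wsum_const[OF assms(2), of 1]
    unfolding is_weights_def mix_def sum_fst by (auto simp: wsum_scale simp del: map_append)
qed

lemma hs_mix:
  "4 * hs (orbit c h (mix L L')) (orbit c h (mix L L'))
    = hs (orbit c h L) (orbit c h L) + 2 * hs (orbit c h L) (orbit c h L') + hs (orbit c h L') (orbit c h L')"
proof -
  have "orbit c h (mix L L') = map (apfst ((*) (1 / 2))) (orbit c h L @ orbit c h L')"
    by (simp add: orbit_def mix_def o_def apfst_def apsnd_def map_prod_def split_beta)
  then show ?thesis
    by (simp add: hs_append_left hs_append_right hs_scale_left hs_scale_right
        hs_commute[of "orbit c h L'" "orbit c h L"] add_divide_distrib del: map_append)
qed

lemma ip_rank1_orbit:
  assumes "h \<in> S"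
  shows "ip (rank1_sum (orbit c h L) h) h = hs (orbit c h L) [(1, h)]"
  using assms by (simp add: ip_rank1_sum orbit_in hs_def power2_eq_square)

text \<open>Parallelogram law: the midpoint also has squared norm at least \<open>d\<close>, which
  forces two nearly minimal averages to be close.\<close>

lemma hs_orbit_diff_le:
  assumes "\<And>L. is_weights L \<Longrightarrow> d \<le> hs (orbit c h L) (orbit c h L)"
    and "is_weights L" "is_weights L'"
    and "hs (orbit c h L) (orbit c h L) \<le> d + a" "hs (orbit c h L') (orbit c h L') \<le> d + b"
  shows "hs (orbit c h L) (orbit c h L) - 2 * hs (orbit c h L) (orbit c h L')
    + hs (orbit c h L') (orbit c h L') \<le> 2 * a + 2 * b"
  using assms(1)[OF is_weights_mix[OF assms(2,3)]] hs_mix[of c h L L'] assms(4,5) by linarith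

text \<open>Here the finite index of \<open>c R\<close> enters. The colour of
  \<open>s = a + c q\<close> records its coset and the coefficients of \<open>A_(cq) h\<close>
  against \<open>P\<close>, rounded to multiples of \<open>\<delta>\<close>; Cauchy-Schwarz leaves
  finitely many rounded values.\<close>

lemma finitely_colourable_coset_coefficients:
  fixes c :: 'a
  assumes c: "c \<noteq> 0" and h: "h \<in> S" and P: "finite P" "P \<subseteq> S" and "\<delta> > 0"
  shows "finitely_colourable (\<lambda>s t. \<exists>a q r. s = a + c * q \<and> t = a + c * r \<and>
    (\<forall>x\<in>P. \<bar>ip x (A (c * q) h) - ip x (A (c * r) h)\<bar> \<le> \<delta>))"
proof -
  define coset where "coset s = (\<lambda>y. s + y) ` range (\<lambda>r. c * r)" for s :: 'a
  \<comment> \<open>Chosen from the coset as a set, so that elements of one coset share literally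
    the same representative.\<close>
  define rep where "rep C = (SOME a. a \<in> C)" for C :: "'a set"
  have "\<exists>q. s = rep (coset s) + c * q" for s
  proof -
    have "s + c * 0 \<in> coset s"
      unfolding coset_def by blast
    then have "rep (coset s) \<in> coset s"
      unfolding rep_def by (rule someI)
    then obtain r where "rep (coset s) = s + c * r"
      unfolding coset_def by blast
    then have "s = rep (coset s) + c * (- r)"
      by simp
    then show ?thesis
      by blast
  qed
  then obtain q where q: "\<And>s. s = rep (coset s) + c * q s"
    by metis
  define k where "k s = (\<lambda>x\<in>P. \<lfloor>ip x (A (c * q s) h) / \<delta>\<rfloor>)" for s
  define N where "N x = nrm x * nrm h / \<delta>" for x
  have "\<lfloor>ip x (A (c * q s) h) / \<delta>\<rfloor> \<in> {\<lfloor>- N x\<rfloor>..\<lfloor>N x\<rfloor>}" if "x \<in> P" for x s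
  proof -
    have "x \<in> S"
      using that P by blast
    then have "\<bar>ip x (A (c * q s) h)\<bar> \<le> nrm x * nrm h"
      using cauchy_schwarz[of x "A (c * q s) h"] h by simp
    then have "\<bar>ip x (A (c * q s) h) / \<delta>\<bar> \<le> N x"
      using \<open>\<delta> > 0\<close> by (simp add: N_def divide_right_mono)
    then have "- N x \<le> ip x (A (c * q s) h) / \<delta>" "ip x (A (c * q s) h) / \<delta> \<le> N x"
      by linarith+
    then show ?thesis
      by (simp add: floor_mono)
  qed
  then have "range k \<subseteq> (\<Pi>\<^sub>E x\<in>P. {\<lfloor>- N x\<rfloor>..\<lfloor>N x\<rfloor>})"
    by (auto simp: k_def)
  then have "finite (range k)"
    by (rule finite_subset) (intro finite_PiE P(1) finite_atLeastAtMost_int)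
  moreover have "finite (range coset)"
    unfolding coset_def by (rule finite_index[OF c])
  moreover have "range (\<lambda>s. (coset s, k s)) \<subseteq> range coset \<times> range k"
    by auto
  ultimately have "finite (range (\<lambda>s. (coset s, k s)))"
    by (meson finite_SigmaI finite_subset)
  then show ?thesis
  proof (rule finitely_colourableI)
    fix s t
    assume eq: "(coset s, k s) = (coset t, k t)"
    have "\<bar>ip x (A (c * q s) h) - ip x (A (c * q t) h)\<bar> \<le> \<delta>" if "x \<in> P" for x
    proof -
      have "k s x = k t x"
        using eq by simp
      then have "\<lfloor>ip x (A (c * q s) h) / \<delta>\<rfloor> = \<lfloor>ip x (A (c * q t) h) / \<delta>\<rfloor>"
        using that by (simp add: k_def)
      then have "\<bar>ip x (A (c * q s) h) / \<delta> - ip x (A (c * q t) h) / \<delta>\<bar> \<le> 1"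
        by linarith
      then show ?thesis
        using \<open>\<delta> > 0\<close> by (simp add: field_simps flip: diff_divide_distrib)
    qed
    moreover have "t = rep (coset s) + c * q t"
      using q[of t] eq by simp
    ultimately show "\<exists>a q r. s = a + c * q \<and> t = a + c * r \<and>
        (\<forall>x\<in>P. \<bar>ip x (A (c * q) h) - ip x (A (c * r) h)\<bar> \<le> \<delta>)"
      using q[of s] by blast
  qed
qed

text \<open>A finite-rank operator sees \<open>A_(cs) h\<close> only through finitely many bounded
  coefficients. Hence the orbit of \<open>l\<close> along \<open>c R\<close> is totally bounded, and
  finitely many cosets extend this to the orbit along the whole ring.\<close>

lemma almost_periodic_if_approx_equivariant:
  assumes c: "c \<noteq> 0" and h: "h \<in> S" and l: "l \<in> S"
    and approx: "\<And>\<eta>. \<eta> > 0 \<Longrightarrow> \<exists>L. is_weights L \<and>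
      (\<forall>s. nrm (A (c * s) l - rank1_sum (orbit c h L) (A (c * s) h)) \<le> \<eta>)"
  shows "l \<in> almost_periodic"
proof -
  have "finitely_colourable (\<lambda>s t. nrm (A s l - A t l) \<le> \<eta>)" if "\<eta> > 0" for \<eta>
  proof -
    have "\<eta> / 3 > 0"
      using that by simp
    then obtain L where L: "is_weights L"
        "\<And>s. nrm (A (c * s) l - rank1_sum (orbit c h L) (A (c * s) h)) \<le> \<eta> / 3"
      using approx by blast
    define K where "K = rank1_sum (orbit c h L)"
    have KS: "K z \<in> S" for z
      unfolding K_def using h by (intro rank1_sum_in orbit_in)
    \<comment> \<open>Keeps the change of the finite-rank term within \<open>\<eta> / 3\<close>; the
      summand \<open>1\<close> guards against \<open>h\<close> of norm zero.\<close>
    define \<delta> where "\<delta> = \<eta> / (3 * (nrm h + 1))"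
    have "\<delta> > 0"
      using that nrm_nonneg[OF h] by (simp add: \<delta>_def add_nonneg_pos)
    then have "finitely_colourable (\<lambda>s t. \<exists>a q r. s = a + c * q \<and> t = a + c * r \<and>
      (\<forall>x\<in>snd ` set (orbit c h L). \<bar>ip x (A (c * q) h) - ip x (A (c * r) h)\<bar> \<le> \<delta>))"
      by (intro finitely_colourable_coset_coefficients c h orbit_in) auto
    then show ?thesis
    proof (rule finitely_colourable_mono, elim exE conjE)
      fix s t a q r
      assume st: "s = a + c * q" "t = a + c * r"
        and close: "\<forall>x\<in>snd ` set (orbit c h L). \<bar>ip x (A (c * q) h) - ip x (A (c * r) h)\<bar> \<le> \<delta>"
      let ?y = "A (c * q) h" and ?z = "A (c * r) h"
      have "nrm (K ?y - K ?z) = nrm (K (?y - ?z))"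
        unfolding K_def using h by (simp add: rank1_sum_minus_arg orbit_in)
      also have "\<dots> \<le> wsum (orbit c h L) (\<lambda>x. \<bar>ip x (?y - ?z)\<bar> * nrm x)"
        unfolding K_def using h L(1) by (intro nrm_rank1_sum_le orbit_in orbit_nonneg)
      also have "\<dots> \<le> wsum (orbit c h L) (\<lambda>x. \<delta> * nrm h)"
      proof (rule wsum_mono_nonneg)
        fix x
        assume x: "x \<in> snd ` set (orbit c h L)"
        then have "x \<in> S" "nrm x = nrm h"
          using h by (auto simp: orbit_def)
        moreover have "\<bar>ip x ?y - ip x ?z\<bar> \<le> \<delta>"
          using close x by blast
        ultimately show "\<bar>ip x (?y - ?z)\<bar> * nrm x \<le> \<delta> * nrm h"
          using h by (auto simp: ip_diff_right intro!: mult_right_mono nrm_nonneg)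
      qed (rule orbit_nonneg[OF L(1)])
      also have "\<dots> = \<delta> * nrm h"
        by (simp add: wsum_orbit wsum_const[OF L(1)])
      also have "\<dots> \<le> \<eta> / 3"
        using that nrm_nonneg[OF h] by (simp add: \<delta>_def field_simps)
      finally have 1: "nrm (K ?y - K ?z) \<le> \<eta> / 3" .
      let ?l = "A (c * q) l" and ?m = "A (c * r) l"
      have "A s l - A t l = A a (?l - ?m)"
        using l by (simp add: A_diff st)
      then have "nrm (A s l - A t l) = nrm ((?l - K ?y) + ((K ?y - K ?z) + (K ?z - ?m)))"
        using l by simp
      also have "\<dots> \<le> nrm (?l - K ?y) + nrm ((K ?y - K ?z) + (K ?z - ?m))"
        using l KS by (intro nrm_triangle) auto
      also have "nrm ((K ?y - K ?z) + (K ?z - ?m)) \<le> nrm (K ?y - K ?z) + nrm (K ?z - ?m)"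
        using l KS by (intro nrm_triangle) auto
      finally show "nrm (A s l - A t l) \<le> \<eta>"
        using 1 L(2)[of q] L(2)[of r] nrm_minus_commute[of "K ?z" ?m] l KS
        by (simp add: K_def)
    qed
  qed
  then show ?thesis
    using l by (simp add: almost_periodic_def)
qed

text \<open>\<open>A_(cs) K h\<close> is the shifted average applied to \<open>A_(cs) h\<close>. The
  shifted average has the same norm as \<open>K\<close>, so both are nearly minimal and therefore
  close in Hilbert-Schmidt norm, which dominates the operator norm. The bound does not depend on
  \<open>s\<close>.\<close>

lemma nrm_rank1_equivariance_le:
  assumes h: "h \<in> S" and d: "\<And>L. is_weights L \<Longrightarrow> d \<le> hs (orbit c h L) (orbit c h L)"
    and L: "is_weights L" "hs (orbit c h L) (orbit c h L) \<le> d + a"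
  shows "nrm (A (c * s) (rank1_sum (orbit c h L) h) - rank1_sum (orbit c h L) (A (c * s) h))
    \<le> sqrt (4 * a * ip h h)"
proof (rule nrm_le_sqrt)
  let ?O = "orbit c h L" and ?O' = "orbit c h (shift s L)" and ?z = "A (c * s) h"
  have "A (c * s) (rank1_sum ?O h) = rank1_sum ?O' ?z"
    using rank1_sum_shift[OF h h] by simp
  moreover have "ip (rank1_sum ?O' ?z - rank1_sum ?O ?z) (rank1_sum ?O' ?z - rank1_sum ?O ?z)
      \<le> (hs ?O' ?O' - 2 * hs ?O' ?O + hs ?O ?O) * ip ?z ?z"
    using h by (intro rank1_sum_diff_bound orbit_in) auto
  moreover have "(hs ?O' ?O' - 2 * hs ?O' ?O + hs ?O ?O) * ip ?z ?z \<le> (2 * a + 2 * a) * ip ?z ?z"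
    using h L
    by (intro mult_right_mono hs_orbit_diff_le[of d] d is_weights_shift ip_nonneg)
       (auto simp: hs_shift)
  ultimately show "ip (A (c * s) (rank1_sum ?O h) - rank1_sum ?O ?z)
      (A (c * s) (rank1_sum ?O h) - rank1_sum ?O ?z) \<le> 4 * a * ip h h"
    using h by simp
qed

text \<open>A sequence of averages of \<open>A_(cv) h \<otimes> A_(cv) h\<close> minimizing the Hilbert-Schmidt norm is Cauchy, and
  almost invariant under the action. So its values at \<open>h\<close> converge to an almost periodic vector \<open>l\<close>, and
  \<open>\<langle>l, h\<rangle>\<close> is at least the infimum \<open>d\<close> of the squared norms.\<close>

lemma weights_hs_small:
  assumes h: "h \<in> S" and orth: "\<And>w. w \<in> almost_periodic \<Longrightarrow> ip h w = 0"
    and c: "c \<noteq> 0" and "\<epsilon> > 0"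
  shows "\<exists>L. is_weights L \<and> hs (orbit c h L) (orbit c h L) < \<epsilon>"
proof -
  define D where "D = (\<lambda>L. hs (orbit c h L) (orbit c h L)) ` Collect is_weights"
  define d where "d = Inf D"
  have bdd: "bdd_below D"
    unfolding D_def using h by (intro bdd_belowI2[of _ 0] hs_nonneg orbit_in)
  have "is_weights [(1 :: real, 0 :: 'a)]"
    by (simp add: is_weights_def)
  then have ne: "D \<noteq> {}"
    unfolding D_def by blast
  have d_le: "d \<le> hs (orbit c h L) (orbit c h L)" if "is_weights L" for L
    unfolding d_def using that bdd by (auto intro!: cInf_lower simp: D_def)
  have "\<exists>L. is_weights L \<and> hs (orbit c h L) (orbit c h L) \<le> d + inverse (real (Suc n))
      \<and> d \<le> hs (orbit c h L) [(1, h)]" for n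
  proof -
    obtain L where L: "is_weights L" "hs (orbit c h L) (orbit c h L) < d + inverse (real (Suc n))"
      using cInf_lessD[OF ne, of "d + inverse (real (Suc n))"] by (auto simp: d_def D_def)
    \<comment> \<open>The squared norm of the average \<open>K\<close> is itself an average, over
      \<open>v\<close>, of products of \<open>K\<close> with
      \<open>A_(cv) h \<otimes> A_(cv) h\<close>. Some \<open>v\<close> gives at least
      \<open>d\<close>; recentring the weights there turns this into
      \<open>ip (K h) h \<ge> d\<close>.\<close>
    have "d \<le> wsum L (\<lambda>v. wsum L (\<lambda>w. (ip (A (c * w) h) (A (c * v) h))\<^sup>2))"
      using d_le[OF L(1)] by (simp add: hs_def wsum_orbit ip_commute)
    then obtain v where v: "d \<le> wsum L (\<lambda>w. (ip (A (c * w) h) (A (c * v) h))\<^sup>2)"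
      using wsum_attains[OF L(1)] by blast
    have "hs (orbit c h (shift (- v) L)) [(1, h)] = wsum L (\<lambda>w. (ip (A (c * (- v + w)) h) h)\<^sup>2)"
      unfolding hs_def wsum_orbit by (simp add: shift_def wsum_map)
    also have "\<dots> = wsum L (\<lambda>w. (ip (A (c * w) h) (A (c * v) h))\<^sup>2)"
      using ip_A_A[OF h h, of "c * _" "- (c * v)"] by (simp add: algebra_simps)
    finally show ?thesis
      using L v h by (intro exI[of _ "shift (- v) L"]) (auto simp: hs_shift is_weights_shift)
  qed
  then obtain L where L: "\<And>n. is_weights (L n)"
      "\<And>n. hs (orbit c h (L n)) (orbit c h (L n)) \<le> d + inverse (real (Suc n))"
      "\<And>n. d \<le> hs (orbit c h (L n)) [(1, h)]"
    by metis
  define X where "X n = rank1_sum (orbit c h (L n)) h" for n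
  have XS: "X n \<in> S" for n
    unfolding X_def using h by (intro rank1_sum_in orbit_in)
  have close: "ip (X m - X n) (X m - X n)
      \<le> (2 * inverse (real (Suc m)) + 2 * inverse (real (Suc n))) * ip h h" for m n
  proof -
    have "ip (X m - X n) (X m - X n) \<le> (hs (orbit c h (L m)) (orbit c h (L m))
        - 2 * hs (orbit c h (L m)) (orbit c h (L n)) + hs (orbit c h (L n)) (orbit c h (L n))) * ip h h"
      unfolding X_def using h by (intro rank1_sum_diff_bound orbit_in)
    also have "\<dots> \<le> (2 * inverse (real (Suc m)) + 2 * inverse (real (Suc n))) * ip h h"
      by (intro mult_right_mono hs_orbit_diff_le[of d] d_le L ip_nonneg h)
    finally show ?thesis .
  qed
  have "\<exists>l\<in>S. (\<lambda>n. ip (X n - l) (X n - l)) \<longlonglongrightarrow> 0"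
  proof (rule complete)
    fix e :: real
    assume "e > 0"
    then have "e / (4 * (ip h h + 1)) > 0"
      using ip_nonneg[OF h] by (simp add: add_nonneg_pos)
    then obtain N where N: "inverse (real (Suc N)) < e / (4 * (ip h h + 1))"
      using reals_Archimedean by blast
    have "ip (X m - X n) (X m - X n) < e" if "m \<ge> N" "n \<ge> N" for m n
    proof -
      have "inverse (real (Suc m)) \<le> inverse (real (Suc N))" "inverse (real (Suc n)) \<le> inverse (real (Suc N))"
        using that by (simp_all add: field_simps)
      then have "2 * inverse (real (Suc m)) + 2 * inverse (real (Suc n)) \<le> 4 * inverse (real (Suc N))"
        by linarith
      then have "ip (X m - X n) (X m - X n) \<le> (4 * inverse (real (Suc N))) * ip h h"
        by (intro order_trans[OF close] mult_right_mono ip_nonneg h)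
      also have "\<dots> \<le> (4 * inverse (real (Suc N))) * (ip h h + 1)"
        by (intro mult_left_mono) auto
      also have "\<dots> < e"
        using N ip_nonneg[OF h] by (simp add: field_simps)
      finally show ?thesis .
    qed
    then show "\<exists>N. \<forall>m\<ge>N. \<forall>n\<ge>N. ip (X m - X n) (X m - X n) < e"
      by blast
  qed (rule XS)
  then obtain l where l: "l \<in> S" "(\<lambda>n. nrm (X n - l)) \<longlonglongrightarrow> 0"
    by (auto dest: nrm_tendsto_zero)
  have "l \<in> almost_periodic"
  proof (rule almost_periodic_if_approx_equivariant[OF c h l(1)])
    fix \<eta> :: real
    assume "\<eta> > 0"
    have "(\<lambda>n. sqrt (4 * inverse (real (Suc n)) * ip h h)) \<longlonglongrightarrow> sqrt (4 * 0 * ip h h)"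
      by (intro tendsto_real_sqrt tendsto_mult tendsto_const LIMSEQ_inverse_real_of_nat)
    then have "(\<lambda>n. nrm (X n - l) + sqrt (4 * inverse (real (Suc n)) * ip h h)) \<longlonglongrightarrow> 0"
      using tendsto_add[OF l(2)] by fastforce
    then have "\<forall>\<^sub>F n in sequentially. nrm (X n - l) + sqrt (4 * inverse (real (Suc n)) * ip h h) < \<eta>"
      using \<open>\<eta> > 0\<close> by (rule order_tendstoD)
    then obtain n where n: "nrm (X n - l) + sqrt (4 * inverse (real (Suc n)) * ip h h) < \<eta>"
      using eventually_sequentially by auto
    have "nrm (A (c * s) l - rank1_sum (orbit c h (L n)) (A (c * s) h)) \<le> \<eta>" for s
    proof -
      let ?K = "rank1_sum (orbit c h (L n)) (A (c * s) h)"
      have K: "?K \<in> S"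
        using h by (intro rank1_sum_in orbit_in)
      have "A (c * s) l - ?K = A (c * s) (l - X n) + (A (c * s) (X n) - ?K)"
        using l XS by (simp add: A_diff)
      also have "nrm \<dots> \<le> nrm (A (c * s) (l - X n)) + nrm (A (c * s) (X n) - ?K)"
        using l XS K by (intro nrm_triangle) auto
      also have "nrm (A (c * s) (l - X n)) = nrm (X n - l)"
        using l XS by (simp add: nrm_minus_commute)
      also have "nrm (A (c * s) (X n) - ?K) \<le> sqrt (4 * inverse (real (Suc n)) * ip h h)"
        unfolding X_def using h d_le L(1,2) by (intro nrm_rank1_equivariance_le)
      finally show ?thesis
        using n by simp
    qed
    then show "\<exists>L. is_weights L \<and>
        (\<forall>s. nrm (A (c * s) l - rank1_sum (orbit c h L) (A (c * s) h)) \<le> \<eta>)"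
      using L(1) by blast
  qed
  then have "ip l h = 0"
    using orth ip_commute by metis
  moreover have "d \<le> ip l h"
  proof (rule LIMSEQ_le_const)
    show "(\<lambda>n. ip (X n) h) \<longlonglongrightarrow> ip l h"
      using XS l h by (intro tendsto_ip)
    show "\<exists>N. \<forall>n\<ge>N. d \<le> ip (X n) h"
      using L(3) h by (simp add: X_def ip_rank1_orbit)
  qed
  ultimately have "Inf D < \<epsilon>"
    using \<open>\<epsilon> > 0\<close> by (simp add: d_def)
  then show ?thesis
    using cInf_lessD[OF ne] by (auto simp: D_def)
qed

text \<open>Moving part of the shift onto \<open>z\<close> replaces it by a vector of the same norm,
  whatever \<open>x\<close> and \<open>w\<close> are. The average over \<open>v\<close> alone is
  then a Hilbert-Schmidt product with a small operator; averaging over \<open>w\<close> afterwards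
  is harmless.\<close>

lemma null_function_weakly_mixing:
  assumes h: "h \<in> S" and orth: "\<And>w. w \<in> almost_periodic \<Longrightarrow> ip h w = 0"
    and c: "c \<noteq> 0" and z: "z \<in> S"
  shows "null_function (\<lambda>s. (ip (A (c * s) h) z)\<^sup>2)"
  unfolding null_function_def
proof (intro conjI allI impI)
  fix \<epsilon> :: real
  assume "\<epsilon> > 0"
  \<comment> \<open>Cauchy-Schwarz bounds the square of the average by
    \<open>\<delta> * (ip z z)\<^sup>2\<close>, which is thereby at most
    \<open>\<epsilon>\<^sup>2\<close>.\<close>
  define \<delta> where "\<delta> = (\<epsilon> / (ip z z + 1))\<^sup>2"
  have "\<delta> > 0"
    using \<open>\<epsilon> > 0\<close> ip_nonneg[OF z] by (simp add: \<delta>_def)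
  then obtain L where L: "is_weights L" "hs (orbit c h L) (orbit c h L) < \<delta>"
    using weights_hs_small[OF h orth c] by blast
  have "wsum L (\<lambda>v. wsum L (\<lambda>w. (ip (A (c * (x + v - w)) h) z)\<^sup>2)) \<le> \<epsilon>" for x
  proof -
    have "wsum L (\<lambda>v. (ip (A (c * (x + v - w)) h) z)\<^sup>2) \<le> \<epsilon>" for w
    proof -
      define y where "y = A (c * (w - x)) z"
      have y: "y \<in> S" "ip y y = ip z z"
        using z by (auto simp: y_def)
      have "wsum L (\<lambda>v. (ip (A (c * (x + v - w)) h) z)\<^sup>2) = hs (orbit c h L) [(1, y)]"
        using ip_A_A[OF h z, of "c * _" "c * (x - w)"]
        by (simp add: hs_def wsum_orbit y_def algebra_simps)
      also have "\<dots> \<le> \<epsilon>"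
      proof (rule power2_le_imp_le)
        have "(hs (orbit c h L) [(1, y)])\<^sup>2 \<le> hs (orbit c h L) (orbit c h L) * hs [(1, y)] [(1, y)]"
          using h y by (intro hs_cauchy_schwarz orbit_in) auto
        also have "\<dots> \<le> \<delta> * (ip z z)\<^sup>2"
          using L(2) by (simp add: hs_def y mult_right_mono)
        also have "\<dots> = (\<epsilon> * (ip z z / (ip z z + 1)))\<^sup>2"
          by (simp add: \<delta>_def power_divide power_mult_distrib)
        also have "\<dots> \<le> \<epsilon>\<^sup>2"
        proof (rule power_mono)
          have "ip z z / (ip z z + 1) \<le> 1"
            using ip_nonneg[OF z] by simp
          then show "\<epsilon> * (ip z z / (ip z z + 1)) \<le> \<epsilon>"
            using \<open>\<epsilon> > 0\<close> by (metis mult.right_neutral mult_left_mono less_imp_le)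
          show "0 \<le> \<epsilon> * (ip z z / (ip z z + 1))"
            using \<open>\<epsilon> > 0\<close> ip_nonneg[OF z] by simp
        qed
        finally show "(hs (orbit c h L) [(1, y)])\<^sup>2 \<le> \<epsilon>\<^sup>2" .
      qed (use \<open>\<epsilon> > 0\<close> in simp)
      finally show ?thesis .
    qed
    then show ?thesis
      by (subst wsum_swap) (rule wsum_le[OF L(1)])
  qed
  then show "\<exists>L. is_weights L \<and> (\<forall>x. wsum L (\<lambda>v. wsum L (\<lambda>w. (ip (A (c * (x + v - w)) h) z)\<^sup>2)) \<le> \<epsilon>)"
    using L(1) by blast
qed simp

end

section \<open>The space of square-integrable functions\<close>

instantiation "fun" :: (type, real_vector) real_vector
begin

definition scaleR_fun :: "real \<Rightarrow> ('a \<Rightarrow> 'b) \<Rightarrow> 'a \<Rightarrow> 'b" where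
  "scaleR_fun a f = (\<lambda>x. a *\<^sub>R f x)"

instance
  by standard (auto simp: scaleR_fun_def fun_eq_iff algebra_simps)

end

lemma scaleR_fun_apply [simp]: "(a *\<^sub>R f) x = a *\<^sub>R f x"
  by (simp add: scaleR_fun_def)

definition L2 :: "'w measure \<Rightarrow> ('w \<Rightarrow> real) set" where
  "L2 M = {f \<in> borel_measurable M. integrable M (\<lambda>\<omega>. (f \<omega>)\<^sup>2)}"

definition L2_inner :: "'w measure \<Rightarrow> ('w \<Rightarrow> real) \<Rightarrow> ('w \<Rightarrow> real) \<Rightarrow> real" where
  "L2_inner M f g = (\<integral>\<omega>. f \<omega> * g \<omega> \<partial>M)"

lemma L2_measurable [measurable_dest]: "f \<in> L2 M \<Longrightarrow> f \<in> borel_measurable M"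
  by (simp add: L2_def)

lemma L2_integrable_square: "f \<in> L2 M \<Longrightarrow> integrable M (\<lambda>\<omega>. (f \<omega>)\<^sup>2)"
  by (simp add: L2_def)

lemma L2_integrable_mult:
  assumes "f \<in> L2 M" "g \<in> L2 M"
  shows "integrable M (\<lambda>\<omega>. f \<omega> * g \<omega>)"
proof (rule Bochner_Integration.integrable_bound)
  show "integrable M (\<lambda>\<omega>. (f \<omega>)\<^sup>2 + (g \<omega>)\<^sup>2)"
    using assms by (auto simp: L2_integrable_square)
  show "(\<lambda>\<omega>. f \<omega> * g \<omega>) \<in> borel_measurable M"
    using assms by (auto dest!: L2_measurable)
  have "\<bar>a * b\<bar> \<le> a\<^sup>2 + b\<^sup>2" for a b :: real
    using sum_squares_bound[of "\<bar>a\<bar>" "\<bar>b\<bar>"] mult_nonneg_nonneg[OF abs_ge_zero[of a] abs_ge_zero[of b]]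
    unfolding abs_mult power2_abs by linarith
  then show "AE \<omega> in M. norm (f \<omega> * g \<omega>) \<le> norm ((f \<omega>)\<^sup>2 + (g \<omega>)\<^sup>2)"
    by auto
qed

lemma subspace_L2: "subspace (L2 M)"
proof (rule subspaceI)
  fix f g and c :: real
  assume f: "f \<in> L2 M" and g: "g \<in> L2 M"
  have "(\<lambda>\<omega>. ((f + g) \<omega>)\<^sup>2) = (\<lambda>\<omega>. (f \<omega>)\<^sup>2 + (g \<omega>)\<^sup>2 + 2 * (f \<omega> * g \<omega>))"
    by (auto simp: power2_sum)
  moreover have "f + g = (\<lambda>\<omega>. f \<omega> + g \<omega>)"
    by auto
  ultimately show "f + g \<in> L2 M"
    using f g L2_integrable_mult[OF f g] by (auto simp: L2_def)
next
  fix f and c :: real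
  assume f: "f \<in> L2 M"
  have "c *\<^sub>R f = (\<lambda>\<omega>. c * f \<omega>)"
    by auto
  then show "c *\<^sub>R f \<in> L2 M"
    using f by (auto simp: L2_def power_mult_distrib)
qed (simp add: L2_def zero_fun_def)

lemma semi_inner_L2: "semi_inner (L2 M) (L2_inner M)"
proof
  fix x y z :: "'a \<Rightarrow> real"
  assume "x \<in> L2 M" "y \<in> L2 M" "z \<in> L2 M"
  then show "L2_inner M (x + y) z = L2_inner M x z + L2_inner M y z"
    by (simp add: L2_inner_def distrib_right L2_integrable_mult)
next
  fix a :: real and x y :: "'a \<Rightarrow> real"
  show "L2_inner M (a *\<^sub>R x) y = a * L2_inner M x y"
    by (simp add: L2_inner_def mult.assoc)
  show "L2_inner M x y = L2_inner M y x"
    by (simp add: L2_inner_def mult.commute)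
qed (auto simp: subspace_L2 L2_inner_def)

lemma integral_sum_list:
  fixes f :: "'b \<Rightarrow> 'a \<Rightarrow> real"
  assumes "\<And>p. p \<in> set P \<Longrightarrow> integrable M (f p)"
  shows "integrable M (\<lambda>\<omega>. \<Sum>p\<leftarrow>P. f p \<omega>)"
    and "(\<integral>\<omega>. (\<Sum>p\<leftarrow>P. f p \<omega>) \<partial>M) = (\<Sum>p\<leftarrow>P. \<integral>\<omega>. f p \<omega> \<partial>M)"
proof -
  have "integrable M (\<lambda>\<omega>. \<Sum>p\<leftarrow>P. f p \<omega>) \<and>
      (\<integral>\<omega>. (\<Sum>p\<leftarrow>P. f p \<omega>) \<partial>M) = (\<Sum>p\<leftarrow>P. \<integral>\<omega>. f p \<omega> \<partial>M)"
    using assms by (induction P) auto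
  then show "integrable M (\<lambda>\<omega>. \<Sum>p\<leftarrow>P. f p \<omega>)"
    and "(\<integral>\<omega>. (\<Sum>p\<leftarrow>P. f p \<omega>) \<partial>M) = (\<Sum>p\<leftarrow>P. \<integral>\<omega>. f p \<omega> \<partial>M)"
    by auto
qed

text \<open>The double sum is the squared norm of one linear combination.\<close>

lemma (in semi_inner) gram_sum_list:
  assumes "snd ` set P \<subseteq> S"
  shows "0 \<le> (\<Sum>p\<leftarrow>P. \<Sum>q\<leftarrow>P. (c p * c q) * ip (snd p) (snd q))"
proof -
  define comb where "comb Q = (\<Sum>p\<leftarrow>Q. c p *\<^sub>R snd p)" for Q
  have comb: "comb Q \<in> S" if "snd ` set Q \<subseteq> S" for Q
    using that unfolding comb_def by (induction Q) auto
  have 1: "ip x (comb Q) = (\<Sum>q\<leftarrow>Q. c q * ip x (snd q))" if "snd ` set Q \<subseteq> S" "x \<in> S" for Q x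
    using that(1)
  proof (induction Q)
    case (Cons q Q)
    have "comb (q # Q) = c q *\<^sub>R snd q + comb Q"
      by (simp add: comb_def)
    then show ?case
      using Cons comb[of Q] that(2) by (simp add: ip_simps)
  qed (use that(2) in \<open>simp add: comb_def\<close>)
  have "ip (comb Q) (comb P) = (\<Sum>p\<leftarrow>Q. \<Sum>q\<leftarrow>P. (c p * c q) * ip (snd p) (snd q))"
    if "snd ` set Q \<subseteq> S" for Q
    using that
  proof (induction Q)
    case (Cons q Q)
    have "comb (q # Q) = c q *\<^sub>R snd q + comb Q"
      by (simp add: comb_def)
    then show ?case
      using Cons comb[of Q] comb[OF assms]
      by (simp add: ip_add_left ip_scale_left 1[OF assms, of "snd q"] sum_list_const_mult mult.assoc)
  qed (use comb[OF assms] in \<open>simp add: comb_def\<close>)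
  then show ?thesis
    using ip_nonneg[OF comb[OF assms]] assms by simp
qed

text \<open>The entrywise product of two Gram matrices is positive semidefinite: integrating the first
  factor pointwise leaves a Gram form of the second one.\<close>

lemma schur_L2:
  assumes P: "set P \<subseteq> L2 M \<times> L2 M"
  shows "0 \<le> (\<Sum>p\<leftarrow>P. \<Sum>q\<leftarrow>P. L2_inner M (fst p) (fst q) * L2_inner M (snd p) (snd q))"
proof -
  interpret semi_inner "L2 M" "L2_inner M"
    by (rule semi_inner_L2)
  have int: "integrable M (\<lambda>\<omega>. (fst p \<omega> * fst q \<omega>) * L2_inner M (snd p) (snd q))"
    if "p \<in> set P" "q \<in> set P" for p q
    using that P by (auto intro!: L2_integrable_mult integrable_mult_left)
  have "0 \<le> (\<integral>\<omega>. (\<Sum>p\<leftarrow>P. \<Sum>q\<leftarrow>P. (fst p \<omega> * fst q \<omega>) * L2_inner M (snd p) (snd q)) \<partial>M)"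
    using P by (intro Bochner_Integration.integral_nonneg gram_sum_list) auto
  also have "\<dots> = (\<Sum>p\<leftarrow>P. \<Sum>q\<leftarrow>P. \<integral>\<omega>. (fst p \<omega> * fst q \<omega>) * L2_inner M (snd p) (snd q) \<partial>M)"
    using int by (simp add: integral_sum_list cong: map_cong)
  also have "\<dots> = (\<Sum>p\<leftarrow>P. \<Sum>q\<leftarrow>P. L2_inner M (fst p) (fst q) * L2_inner M (snd p) (snd q))"
    by (simp add: L2_inner_def)
  finally show ?thesis .
qed

section \<open>Completeness of the space of square-integrable functions\<close>

lemma const_in_L2: "finite_measure M \<Longrightarrow> (\<lambda>_. c) \<in> L2 M"
  by (simp add: L2_def finite_measure.integrable_const)

lemma (in prob_space) L2_integral_abs_le:
  assumes f: "f \<in> L2 M"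
  shows "integrable M f" and "(\<integral>\<omega>. \<bar>f \<omega>\<bar> \<partial>M) \<le> sqrt (L2_inner M f f)"
proof -
  interpret semi_inner "L2 M" "L2_inner M"
    by (rule semi_inner_L2)
  have 1: "(\<lambda>_. 1) \<in> L2 M"
    by (rule const_in_L2) unfold_locales
  show "integrable M f"
    using L2_integrable_mult[OF f 1] by simp
  note [measurable] = L2_measurable[OF f]
  have g: "(\<lambda>\<omega>. \<bar>f \<omega>\<bar>) \<in> L2 M"
    using f by (simp add: L2_def)
  have "L2_inner M (\<lambda>\<omega>. \<bar>f \<omega>\<bar>) (\<lambda>_. 1) \<le> nrm (\<lambda>\<omega>. \<bar>f \<omega>\<bar>) * nrm (\<lambda>_. 1)"
    using cauchy_schwarz[OF g 1] by linarith
  then show "(\<integral>\<omega>. \<bar>f \<omega>\<bar> \<partial>M) \<le> sqrt (L2_inner M f f)"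
    by (simp add: L2_inner_def nrm_def prob_space)
qed

text \<open>On a probability space the \<open>L\<^sup>1\<close> norm is at most the
  \<open>L\<^sup>2\<close> norm, so the increments have summable integrals and are absolutely
  summable almost everywhere.\<close>

lemma (in prob_space) L2_AE_convergent:
  assumes X: "\<And>n. X n \<in> L2 M"
    and fast: "\<And>i. sqrt (L2_inner M (X (Suc i) - X i) (X (Suc i) - X i)) \<le> (1 / 2) ^ i"
  shows "AE \<omega> in M. convergent (\<lambda>i. X i \<omega>)"
proof -
  interpret semi_inner "L2 M" "L2_inner M"
    by (rule semi_inner_L2)
  define d where "d i = X (Suc i) - X i" for i
  have d: "d i \<in> L2 M" for i
    using X by (simp add: d_def)
  note [measurable] = L2_measurable[OF d]
  have "(\<integral>\<^sup>+\<omega>. (\<Sum>i. ennreal \<bar>d i \<omega>\<bar>) \<partial>M) = (\<Sum>i. \<integral>\<^sup>+\<omega>. ennreal \<bar>d i \<omega>\<bar> \<partial>M)"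
    by (rule nn_integral_suminf) measurable
  also have "\<dots> \<le> (\<Sum>i. ennreal ((1 / 2) ^ i))"
  proof (intro suminf_le allI)
    fix i
    have "(\<integral>\<^sup>+\<omega>. ennreal \<bar>d i \<omega>\<bar> \<partial>M) = ennreal (\<integral>\<omega>. \<bar>d i \<omega>\<bar> \<partial>M)"
      using L2_integral_abs_le(1)[OF d] by (intro nn_integral_eq_integral) auto
    also have "\<dots> \<le> ennreal ((1 / 2) ^ i)"
      using order_trans[OF L2_integral_abs_le(2)[OF d] fast[folded d_def]] by (rule ennreal_leI)
    finally show "(\<integral>\<^sup>+\<omega>. ennreal \<bar>d i \<omega>\<bar> \<partial>M) \<le> ennreal ((1 / 2) ^ i)" .
  qed auto
  also have "\<dots> = ennreal (\<Sum>i. (1 / 2) ^ i)"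
    by (intro suminf_ennreal2) (auto intro!: summable_geometric)
  also have "\<dots> < \<infinity>"
    by simp
  finally have "AE \<omega> in M. (\<Sum>i. ennreal \<bar>d i \<omega>\<bar>) \<noteq> \<infinity>"
    by (intro nn_integral_PInf_AE) auto
  then show ?thesis
  proof eventually_elim
    case (elim \<omega>)
    then have "summable (\<lambda>i. \<bar>d i \<omega>\<bar>)"
      by (intro summable_suminf_not_top) auto
    then have "convergent (\<lambda>n. \<Sum>i<n. d i \<omega>)"
      using summable_rabs_cancel summable_iff_convergent by blast
    then have "convergent (\<lambda>n. X n \<omega> - X 0 \<omega>)"
      by (simp add: d_def sum_lessThan_telescope[of "\<lambda>n. X n \<omega>"])
    then have "convergent (\<lambda>n. (X n \<omega> - X 0 \<omega>) + X 0 \<omega>)"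
      by (intro convergent_add convergent_const)
    then show ?case
      by simp
  qed
qed

text \<open>Riesz-Fischer: a fast subsequence converges almost everywhere, and Fatou's lemma turns
  the Cauchy bounds into bounds on the distance from its limit.\<close>

lemma (in prob_space) L2_complete:
  assumes X: "\<And>n. X n \<in> L2 M"
    and Cauchy: "\<And>e. e > 0 \<Longrightarrow> \<exists>N. \<forall>m\<ge>N. \<forall>n\<ge>N. L2_inner M (X m - X n) (X m - X n) < e"
  shows "\<exists>l\<in>L2 M. (\<lambda>n. L2_inner M (X n - l) (X n - l)) \<longlonglongrightarrow> 0"
proof -
  interpret semi_inner "L2 M" "L2_inner M"
    by (rule semi_inner_L2)
  have "\<exists>N. \<forall>m\<ge>N. \<forall>n\<ge>N. L2_inner M (X m - X n) (X m - X n) < (1 / 4) ^ i" for i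
    by (rule Cauchy) simp
  then obtain N where N: "\<And>i m n. N i \<le> m \<Longrightarrow> N i \<le> n \<Longrightarrow> L2_inner M (X m - X n) (X m - X n) < (1 / 4) ^ i"
    by metis
  \<comment> \<open>The sum makes \<open>k\<close> increasing and at least \<open>N i\<close>; the
    summand \<open>i\<close> makes it unbounded. Squared distances below \<open>(1 / 4) ^ i\<close>
    are distances below \<open>(1 / 2) ^ i\<close>.\<close>
  define k where "k i = (\<Sum>j\<le>i. N j) + i" for i
  have k: "N i \<le> k i" "k i \<le> k (Suc i)" "i \<le> k i" for i
    unfolding k_def by (auto intro!: trans_le_add1 member_le_sum)
  have "AE \<omega> in M. convergent (\<lambda>i. X (k i) \<omega>)"
  proof (rule L2_AE_convergent)
    fix i
    have "N i \<le> k (Suc i)"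
      using k order_trans by blast
    then have "L2_inner M (X (k (Suc i)) - X (k i)) (X (k (Suc i)) - X (k i)) \<le> (1 / 4) ^ i"
      using k(1) by (intro less_imp_le[OF N])
    then have "sqrt (L2_inner M (X (k (Suc i)) - X (k i)) (X (k (Suc i)) - X (k i))) \<le> sqrt ((1 / 4) ^ i)"
      by simp
    also have "\<dots> = (1 / 2) ^ i"
      by (simp add: real_sqrt_power real_sqrt_divide)
    finally show "sqrt (L2_inner M (X (k (Suc i)) - X (k i)) (X (k (Suc i)) - X (k i))) \<le> (1 / 2) ^ i" .
  qed (rule X)
  note AE_conv = this
  define l where "l \<omega> = lim (\<lambda>i. X (k i) \<omega>)" for \<omega>
  note [measurable] = L2_measurable[OF X]
  have l [measurable]: "l \<in> borel_measurable M"
    unfolding l_def by measurable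
  \<comment> \<open>Only measurability of \<open>l\<close> is known so far, so the bound is on the
    nonnegative integral; square-integrability follows from it.\<close>
  have fatou: "(\<integral>\<^sup>+\<omega>. ennreal ((X m \<omega> - l \<omega>)\<^sup>2) \<partial>M) \<le> ennreal e"
    if N: "\<forall>m\<ge>N. \<forall>n\<ge>N. L2_inner M (X m - X n) (X m - X n) < e" and "m \<ge> N" for e N m
  proof -
    have "(\<integral>\<^sup>+\<omega>. ennreal ((X m \<omega> - l \<omega>)\<^sup>2) \<partial>M)
        = (\<integral>\<^sup>+\<omega>. liminf (\<lambda>i. ennreal ((X m \<omega> - X (k i) \<omega>)\<^sup>2)) \<partial>M)"
    proof (rule nn_integral_cong_AE)
      show "AE \<omega> in M. ennreal ((X m \<omega> - l \<omega>)\<^sup>2) = liminf (\<lambda>i. ennreal ((X m \<omega> - X (k i) \<omega>)\<^sup>2))"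
        using AE_conv
      proof eventually_elim
        case (elim \<omega>)
        then have "(\<lambda>i. X (k i) \<omega>) \<longlonglongrightarrow> l \<omega>"
          by (simp add: l_def convergent_LIMSEQ_iff)
        then have "(\<lambda>i. ennreal ((X m \<omega> - X (k i) \<omega>)\<^sup>2)) \<longlonglongrightarrow> ennreal ((X m \<omega> - l \<omega>)\<^sup>2)"
          by (intro tendsto_intros) auto
        from lim_imp_Liminf[OF _ this] show ?case
          by simp
      qed
    qed
    also have "\<dots> \<le> liminf (\<lambda>i. \<integral>\<^sup>+\<omega>. ennreal ((X m \<omega> - X (k i) \<omega>)\<^sup>2) \<partial>M)"
      by (rule nn_integral_liminf) measurable
    also have "\<dots> \<le> ennreal e"
    proof (rule order_trans[OF Liminf_le_Limsup], simp, rule Limsup_bounded)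
      show "\<forall>\<^sub>F i in sequentially. (\<integral>\<^sup>+\<omega>. ennreal ((X m \<omega> - X (k i) \<omega>)\<^sup>2) \<partial>M) \<le> ennreal e"
        unfolding eventually_sequentially
      proof (intro exI[of _ N] allI impI)
        fix i
        assume "N \<le> i"
        then have "N \<le> k i"
          using k(3) order_trans by blast
        have "(\<integral>\<^sup>+\<omega>. ennreal ((X m \<omega> - X (k i) \<omega>)\<^sup>2) \<partial>M)
            = ennreal (L2_inner M (X m - X (k i)) (X m - X (k i)))"
          using L2_integrable_square[OF S_diff[OF X X, of m "k i"]]
          by (subst nn_integral_eq_integral) (auto simp: L2_inner_def power2_eq_square)
        also have "\<dots> \<le> ennreal e"
          using N \<open>m \<ge> N\<close> \<open>N \<le> k i\<close> by (intro ennreal_leI less_imp_le) auto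
        finally show "(\<integral>\<^sup>+\<omega>. ennreal ((X m \<omega> - X (k i) \<omega>)\<^sup>2) \<partial>M) \<le> ennreal e" .
      qed
    qed
    finally show ?thesis .
  qed
  have diff: "X m - l \<in> L2 M \<and> L2_inner M (X m - l) (X m - l) \<le> e"
    if N: "\<forall>m\<ge>N. \<forall>n\<ge>N. L2_inner M (X m - X n) (X m - X n) < e" "m \<ge> N" and "e > 0" for e N m
  proof
    have "integrable M (\<lambda>\<omega>. (X m \<omega> - l \<omega>)\<^sup>2)"
      using fatou[OF N] by (intro integrableI_bounded) (auto simp: less_top intro: le_less_trans)
    moreover have "X m - l = (\<lambda>\<omega>. X m \<omega> - l \<omega>)"
      by auto
    ultimately show "X m - l \<in> L2 M"
      by (simp add: L2_def)
    have "ennreal (\<integral>\<omega>. (X m \<omega> - l \<omega>)\<^sup>2 \<partial>M) \<le> ennreal e"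
      using fatou[OF N] \<open>integrable M (\<lambda>\<omega>. (X m \<omega> - l \<omega>)\<^sup>2)\<close> by (simp add: nn_integral_eq_integral)
    then show "L2_inner M (X m - l) (X m - l) \<le> e"
      using \<open>e > 0\<close> by (simp add: L2_inner_def power2_eq_square)
  qed
  obtain N0 where "\<forall>m\<ge>N0. \<forall>n\<ge>N0. L2_inner M (X m - X n) (X m - X n) < 1"
    using Cauchy[of 1] by auto
  then have "X N0 - l \<in> L2 M"
    using diff[of N0 1 N0] by simp
  then have lL2: "l \<in> L2 M"
    using S_diff[OF X[of N0] \<open>X N0 - l \<in> L2 M\<close>] by simp
  moreover have "(\<lambda>n. L2_inner M (X n - l) (X n - l)) \<longlonglongrightarrow> 0"
  proof (rule LIMSEQ_I)
    fix r :: real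
    assume "r > 0"
    then obtain N where N: "\<forall>m\<ge>N. \<forall>n\<ge>N. L2_inner M (X m - X n) (X m - X n) < r / 2"
      using Cauchy[of "r / 2"] by auto
    have "norm (L2_inner M (X n - l) (X n - l) - 0) < r" if "n \<ge> N" for n
    proof -
      have "L2_inner M (X n - l) (X n - l) \<le> r / 2"
        using diff[OF N that] \<open>r > 0\<close> by simp
      moreover have "0 \<le> L2_inner M (X n - l) (X n - l)"
        using X lL2 by (simp add: ip_nonneg)
      ultimately show ?thesis
        using \<open>r > 0\<close> by simp
    qed
    then show "\<exists>N. \<forall>n\<ge>N. norm (L2_inner M (X n - l) (X n - l) - 0) < r"
      by blast
  qed
  ultimately show ?thesis
    by blast
qed

section \<open>Correlations along a sequence\<close>

lemma sum_symmetric_split: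
  fixes F :: "nat \<Rightarrow> nat \<Rightarrow> real"
  assumes L: "finite L" and F: "\<And>l m. F l m = F m l"
  shows "(\<Sum>m\<in>L. \<Sum>l\<in>L. F m l) = (\<Sum>m\<in>L. F m m) + 2 * (\<Sum>m\<in>L. \<Sum>l\<in>{l\<in>L. l < m}. F m l)"
proof -
  have "(\<Sum>l\<in>L. F m l) = F m m + (\<Sum>l\<in>{l\<in>L. l < m}. F m l) + (\<Sum>l\<in>{l\<in>L. m < l}. F m l)"
    if "m \<in> L" for m
  proof -
    have "L = insert m ({l\<in>L. l < m} \<union> {l\<in>L. m < l})"
      using that by auto
    then have "(\<Sum>l\<in>L. F m l) = (\<Sum>l\<in>insert m ({l\<in>L. l < m} \<union> {l\<in>L. m < l}). F m l)"
      by simp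
    also have "\<dots> = F m m + (\<Sum>l\<in>{l\<in>L. l < m} \<union> {l\<in>L. m < l}. F m l)"
      using L by (intro sum.insert) auto
    also have "(\<Sum>l\<in>{l\<in>L. l < m} \<union> {l\<in>L. m < l}. F m l)
        = (\<Sum>l\<in>{l\<in>L. l < m}. F m l) + (\<Sum>l\<in>{l\<in>L. m < l}. F m l)"
      using L by (intro sum.union_disjoint) auto
    finally show ?thesis
      by simp
  qed
  moreover have "(\<Sum>m\<in>L. \<Sum>l\<in>{l\<in>L. m < l}. F m l) = (\<Sum>m\<in>L. \<Sum>l\<in>{l\<in>L. l < m}. F m l)"
    using sum.swap_restrict[OF L L, of F "(<)"] by (simp add: F)
  ultimately show ?thesis
    by (simp add: sum.distrib)
qed

context additive_rep
begin

lemma nrm_sum_almost_orthogonal: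
  assumes "finite L" and h: "\<And>l. l \<in> L \<Longrightarrow> h l \<in> S" "\<And>l. l \<in> L \<Longrightarrow> nrm (h l) \<le> 1"
    and orth: "\<And>l l'. l \<in> L \<Longrightarrow> l' \<in> L \<Longrightarrow> l \<noteq> l' \<Longrightarrow> \<bar>ip (h l) (h l')\<bar> \<le> \<epsilon>" and "\<epsilon> \<ge> 0"
  shows "nrm (\<Sum>l\<in>L. h l) \<le> sqrt (real (card L) + (real (card L))\<^sup>2 * \<epsilon>)"
proof (rule nrm_le_sqrt)
  have "ip (\<Sum>l\<in>L. h l) (\<Sum>l\<in>L. h l) = (\<Sum>l\<in>L. \<Sum>l'\<in>L. ip (h l) (h l'))"
    using h by (subst ip_sum_left) (auto simp: ip_sum_right S_sum)
  also have "\<dots> \<le> (\<Sum>l\<in>L. \<Sum>l'\<in>L. (if l' = l then 1 else 0) + \<epsilon>)"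
  proof (intro sum_mono)
    fix l l'
    assume l: "l \<in> L" "l' \<in> L"
    have "ip (h l) (h l) \<le> 1"
      using h[OF l(1)] nrm_nonneg[of "h l"] by (simp add: power_le_one flip: nrm_sq)
    then show "ip (h l) (h l') \<le> (if l' = l then 1 else 0) + \<epsilon>"
      using orth[OF l] \<open>\<epsilon> \<ge> 0\<close> by (cases "l' = l") auto
  qed
  also have "\<dots> = real (card L) + (real (card L))\<^sup>2 * \<epsilon>"
    using \<open>finite L\<close> by (simp add: sum.distrib power2_eq_square distrib_left)
  finally show "ip (\<Sum>l\<in>L. h l) (\<Sum>l\<in>L. h l) \<le> real (card L) + (real (card L))\<^sup>2 * \<epsilon>" .
qed

text \<open>Nothing is asked of \<open>V m\<close>, which is going to depend on the shifts. Each
  \<open>V l\<close> has a shift \<open>c l\<close> of its own.\<close>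

definition good_shift :: "real \<Rightarrow> (nat \<Rightarrow> 'v) \<Rightarrow> nat \<Rightarrow> (nat \<Rightarrow> 'a) \<Rightarrow> bool" where
  "good_shift \<epsilon> V m c \<longleftrightarrow>
     (\<forall>l<m. nrm (A (c l) (ap_part (V l)) - ap_part (V l)) \<le> \<epsilon>) \<and>
     (\<forall>l'<m. \<forall>l<l'. \<bar>ip (A (c l') (V l' - ap_part (V l'))) (A (c l) (V l - ap_part (V l)))\<bar> \<le> \<epsilon>)"

text \<open>All shifts are multiples of one element. Moving one of them across the inner product
  leaves the multiplier \<open>d l' - d l\<close>, which is nonzero, so weak mixing along its
  multiples applies. The form of that element is the one delivered by
  \<open>thick_recurrence\<close>.\<close>

lemma good_shift_large:
  assumes V: "\<And>l. l < m \<Longrightarrow> V l \<in> S" and d: "\<And>l l'. l < l' \<Longrightarrow> l' < m \<Longrightarrow> d l \<noteq> d l'"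
    and "\<epsilon> > 0"
  shows "\<exists>r \<psi>. finitely_colourable r \<and> null_function \<psi> \<and>
    (\<forall>s t v w. r s t \<longrightarrow> r v w \<longrightarrow> \<psi> (s - t + (v - w)) \<le> \<epsilon>\<^sup>2 \<longrightarrow>
      good_shift \<epsilon> V m (\<lambda>l. d l * (s - t + (v - w))))"
proof -
  define g where "g l = ap_part (V l)" for l
  define h where "h l = V l - ap_part (V l)" for l
  have S: "g l \<in> S" "h l \<in> S" if "l < m" for l
    using V[OF that] by (auto simp: g_def h_def)
  \<comment> \<open>Half of \<open>\<epsilon>\<close>, because the element is a sum of two
    differences and each of them moves \<open>g l\<close> once.\<close>
  define r where "r s t \<longleftrightarrow> (\<forall>l\<in>{..<m}. nrm (A (d l * s) (g l) - A (d l * t) (g l)) \<le> \<epsilon> / 2)" for s t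
  define I where "I = (SIGMA l':{..<m}. {..<l'})"
  define \<psi> where "\<psi> s = (\<Sum>p\<in>I. (ip (A ((d (fst p) - d (snd p)) * s) (h (fst p))) (h (snd p)))\<^sup>2)" for s
  have I: "finite I"
    by (simp add: I_def)
  have "finitely_colourable r"
    unfolding r_def
  proof (rule finitely_colourable_Ball)
    fix l
    assume "l \<in> {..<m}"
    then have "g l \<in> almost_periodic"
      using V by (simp add: g_def ap_part_almost_periodic)
    then have "finitely_colourable (\<lambda>s t. nrm (A s (g l) - A t (g l)) \<le> \<epsilon> / 2)"
      using \<open>\<epsilon> > 0\<close> by (intro finitely_colourable_almost_periodic) auto
    then show "finitely_colourable (\<lambda>s t. nrm (A (d l * s) (g l) - A (d l * t) (g l)) \<le> \<epsilon> / 2)"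
      by (rule finitely_colourable_comp)
  qed simp
  moreover have "null_function \<psi>"
    unfolding \<psi>_def
  proof (intro null_function_sum I null_function_weakly_mixing)
    fix p and x
    assume p: "p \<in> I"
    then show "h (fst p) \<in> S" "h (snd p) \<in> S" "d (fst p) - d (snd p) \<noteq> 0"
      using S d[of "snd p" "fst p"] by (auto simp: I_def)
    assume "x \<in> almost_periodic"
    then show "ip (h (fst p)) x = 0"
      using V p by (auto simp: h_def I_def ip_ap_part)
  qed
  moreover have "good_shift \<epsilon> V m (\<lambda>l. d l * (s - t + (v - w)))"
    if "r s t" "r v w" and \<psi>: "\<psi> (s - t + (v - w)) \<le> \<epsilon>\<^sup>2" for s t v w
  proof -
    define x where "x = s - t + (v - w)"
    have "nrm (A (d l * x) (g l) - g l) \<le> \<epsilon>" if "l < m" for l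
    proof -
      have eq: "A (d l * x) (g l) - g l
          = A (d l * (s - t)) (A (d l * (v - w)) (g l) - g l) + (A (d l * (s - t)) (g l) - g l)"
        using S(1)[OF that] by (simp add: A_diff x_def algebra_simps)
      have "nrm (A (d l * x) (g l) - g l)
          \<le> nrm (A (d l * (v - w)) (g l) - g l) + nrm (A (d l * (s - t)) (g l) - g l)"
        unfolding eq using S(1)[OF that]
          nrm_triangle[of "A (d l * (s - t)) (A (d l * (v - w)) (g l) - g l)" "A (d l * (s - t)) (g l) - g l"]
        by (simp del: A_A)
      moreover have "nrm (A (d l * (v - w)) (g l) - g l) \<le> \<epsilon> / 2" "nrm (A (d l * (s - t)) (g l) - g l) \<le> \<epsilon> / 2"
        using \<open>r s t\<close> \<open>r v w\<close> that
        unfolding right_diff_distrib nrm_A_diff[OF S(1)[OF that], symmetric] by (auto simp: r_def)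
      ultimately show ?thesis
        by simp
    qed
    moreover have "\<bar>ip (A (d l' * x) (h l')) (A (d l * x) (h l))\<bar> \<le> \<epsilon>" if "l' < m" "l < l'" for l l'
    proof -
      have "(ip (A ((d l' - d l) * x) (h l')) (h l))\<^sup>2 \<le> \<psi> x"
        unfolding \<psi>_def using I that member_le_sum[of "(l', l)" I
          "\<lambda>p. (ip (A ((d (fst p) - d (snd p)) * x) (h (fst p))) (h (snd p)))\<^sup>2"]
        by (auto simp: I_def)
      then have "(ip (A ((d l' - d l) * x) (h l')) (h l))\<^sup>2 \<le> \<epsilon>\<^sup>2"
        using \<psi> by (simp add: x_def)
      then have "\<bar>ip (A ((d l' - d l) * x) (h l')) (h l)\<bar> \<le> \<epsilon>"
        using \<open>\<epsilon> > 0\<close> by (simp add: abs_le_square_iff[symmetric])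
      moreover have "ip (A ((d l' - d l) * x) (h l')) (h l) = ip (A (d l' * x) (h l')) (A (d l * x) (h l))"
        using ip_A_A[of "h l'" "h l" "d l' * x" "- (d l * x)"] S(2) that
        by (simp add: left_diff_distrib)
      ultimately show ?thesis
        by simp
    qed
    ultimately show ?thesis
      by (simp add: good_shift_def g_def h_def x_def)
  qed
  ultimately show ?thesis
    by blast
qed

text \<open>Orthogonality of \<open>h m\<close> and \<open>g l\<close> turns
  \<open>ip (g m) (g l)\<close> into \<open>ip (V m) (g l)\<close>. This is the correlation, up to
  the error in almost fixing \<open>g l\<close> and the product of \<open>V m\<close> with the
  shifted \<open>h l\<close>; summed over \<open>l\<close>, these products pair \<open>V m\<close>
  with a single short vector.\<close>

lemma good_shift_correlation:
  fixes V :: "nat \<Rightarrow> 'v" and c :: "nat \<Rightarrow> nat \<Rightarrow> 'a"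
  assumes V: "\<And>l. V l \<in> S" "\<And>l. nrm (V l) \<le> 1" and "\<epsilon> \<ge> 0"
    and L: "finite L"
    and good: "good_shift \<epsilon> V m (c m)"
    and small: "\<And>l. l \<in> L \<Longrightarrow> l < m \<Longrightarrow> ip (V m) (A (c m l) (V l)) \<le> \<rho>"
  shows "(\<Sum>l\<in>{l\<in>L. l < m}. ip (ap_part (V m)) (ap_part (V l)))
    \<le> real (card {l\<in>L. l < m}) * (\<rho> + \<epsilon>) + sqrt (real (card L) + (real (card L))\<^sup>2 * \<epsilon>)"
proof -
  define K where "K = {l\<in>L. l < m}"
  define g where "g l = ap_part (V l)" for l
  define h where "h l = V l - ap_part (V l)" for l
  have S: "g l \<in> S" "h l \<in> S" for l
    using V by (auto simp: g_def h_def)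
  have K: "finite K" "card K \<le> card L"
    using L by (auto simp: K_def intro: card_mono)
  \<comment> \<open>The mixing term is carried along exactly, with its sign inside the vector,
    because only its sum over \<open>l\<close> is small.\<close>
  have "ip (g m) (g l) \<le> (\<rho> + \<epsilon>) + ip (V m) ((-1) *\<^sub>R A (c m l) (h l))" if "l \<in> K" for l
  proof -
    have l: "l \<in> L" "l < m"
      using that by (auto simp: K_def)
    have "ip (h m) (g l) = 0"
      using V by (simp add: h_def g_def ip_ap_part ap_part_almost_periodic)
    then have "ip (V m) (g l) = ip (g m) (g l)"
      using V S by (simp add: h_def g_def ip_diff_left)
    moreover have "V l = g l + h l"
      by (simp add: g_def h_def)
    then have "ip (V m) (A (c m l) (V l))
        = ip (V m) (g l) + ip (V m) (A (c m l) (g l) - g l) + ip (V m) (A (c m l) (h l))"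
      using V S by (simp add: A_add ip_add_right ip_diff_right)
    moreover have "\<bar>ip (V m) (A (c m l) (g l) - g l)\<bar> \<le> 1 * \<epsilon>"
    proof (rule order_trans[OF cauchy_schwarz])
      show "nrm (V m) * nrm (A (c m l) (g l) - g l) \<le> 1 * \<epsilon>"
        using good l(2) V S by (intro mult_mono) (auto simp: good_shift_def g_def intro!: nrm_nonneg)
    qed (use V S in auto)
    ultimately show ?thesis
      using small[OF l] unfolding ip_scale_right[OF V(1) A_in[OF S(2)]] by linarith
  qed
  then have "(\<Sum>l\<in>K. ip (g m) (g l)) \<le> (\<Sum>l\<in>K. (\<rho> + \<epsilon>) + ip (V m) ((-1) *\<^sub>R A (c m l) (h l)))"
    by (rule sum_mono)
  also have "\<dots> = real (card K) * (\<rho> + \<epsilon>) + ip (V m) (\<Sum>l\<in>K. (-1) *\<^sub>R A (c m l) (h l))"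
    using V S by (subst ip_sum_right) (auto simp: sum.distrib intro!: S_scale A_in)
  also have "ip (V m) (\<Sum>l\<in>K. (-1) *\<^sub>R A (c m l) (h l))
      \<le> nrm (V m) * nrm (\<Sum>l\<in>K. (-1) *\<^sub>R A (c m l) (h l))"
    using V S by (intro order_trans[OF abs_ge_self cauchy_schwarz] S_sum S_scale A_in)
  also have "\<dots> \<le> 1 * nrm (\<Sum>l\<in>K. (-1) *\<^sub>R A (c m l) (h l))"
    using V S by (intro mult_right_mono nrm_nonneg S_sum S_scale A_in)
  also have "nrm (\<Sum>l\<in>K. (-1) *\<^sub>R A (c m l) (h l)) \<le> sqrt (real (card K) + (real (card K))\<^sup>2 * \<epsilon>)"
  proof (rule nrm_sum_almost_orthogonal[OF K(1)])
    fix l l'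
    assume l: "l \<in> K" "l' \<in> K" "l \<noteq> l'"
    have "\<bar>ip (A (c m j) (h j)) (A (c m k) (h k))\<bar> \<le> \<epsilon>" if "j < m" "k < j" for j k
      using good that by (simp add: good_shift_def h_def)
    from this[of l l'] this[of l' l] have "\<bar>ip (A (c m l) (h l)) (A (c m l') (h l'))\<bar> \<le> \<epsilon>"
      using l by (cases l l' rule: linorder_cases) (auto simp: K_def ip_commute)
    then show "\<bar>ip ((-1) *\<^sub>R A (c m l) (h l)) ((-1) *\<^sub>R A (c m l') (h l'))\<bar> \<le> \<epsilon>"
      using S by (simp add: ip_scale_left ip_scale_right)
  next
    fix l
    have "nrm (h l) \<le> 1"
      unfolding h_def using V by (intro order_trans[OF nrm_weakly_mixing_part_le])
    then show "nrm ((-1) *\<^sub>R A (c m l) (h l)) \<le> 1"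
      using S by (simp add: nrm_scale)
  qed (use S \<open>\<epsilon> \<ge> 0\<close> in auto)
  also have "\<dots> \<le> sqrt (real (card L) + (real (card L))\<^sup>2 * \<epsilon>)"
    using K(2) \<open>\<epsilon> \<ge> 0\<close> by (intro real_sqrt_le_mono add_mono mult_right_mono power_mono) auto
  finally show ?thesis
    by (simp add: K_def g_def)
qed

text \<open>The invariant vector \<open>e\<close> is almost periodic, hence orthogonal to the weakly
  mixing parts; paired with the sum of the \<open>g l\<close> it gives \<open>P * \<mu>\<close>. By
  Cauchy-Schwarz the Gram sum is at least the square of this. The diagonal contributes at most
  \<open>P\<close>, and the part below it is bounded row by row.\<close>

lemma correlation_lower_bound:
  fixes V :: "nat \<Rightarrow> 'v" and c :: "nat \<Rightarrow> nat \<Rightarrow> 'a"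
  assumes V: "\<And>l. V l \<in> S" "\<And>l. nrm (V l) \<le> 1" and "\<epsilon> \<ge> 0" and "\<rho> \<ge> 0"
    and e: "e \<in> S" "nrm e \<le> 1" "\<And>s. A s e = e" and \<mu>: "\<And>l. ip (V l) e = \<mu>"
    and L: "finite L"
    and good: "\<And>m. m \<in> L \<Longrightarrow> good_shift \<epsilon> V m (c m)"
    and small: "\<And>l m. l \<in> L \<Longrightarrow> m \<in> L \<Longrightarrow> l < m \<Longrightarrow> ip (V m) (A (c m l) (V l)) \<le> \<rho>"
    and P: "P = real (card L)"
  shows "P\<^sup>2 * \<mu>\<^sup>2 \<le> P + P\<^sup>2 * (\<rho> + \<epsilon>) + 2 * P * sqrt (P + P\<^sup>2 * \<epsilon>)"
proof -
  define g where "g l = ap_part (V l)" for l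
  have S: "g l \<in> S" for l
    using V by (auto simp: g_def)
  have "ip (V l - g l) e = 0" for l
    using V e unfolding g_def by (intro ip_ap_part invariant_almost_periodic)
  then have g\<mu>: "ip (g l) e = \<mu>" for l
    using V S e \<mu> by (simp add: ip_diff_left)
  let ?G = "\<Sum>l\<in>L. g l"
  have "P\<^sup>2 * \<mu>\<^sup>2 = (ip ?G e)\<^sup>2"
    using S e by (simp add: ip_sum_left g\<mu> P power_mult_distrib)
  also have "\<dots> \<le> ip ?G ?G * ip e e"
    using S e by (intro ip_sq_le S_sum)
  also have "\<dots> \<le> ip ?G ?G * 1"
    using S e nrm_nonneg[OF e(1)]
    by (intro mult_left_mono ip_nonneg S_sum) (auto simp: power_le_one simp flip: nrm_sq)
  also have "\<dots> = (\<Sum>m\<in>L. \<Sum>l\<in>L. ip (g m) (g l))"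
    using S by (subst ip_sum_left) (auto simp: ip_sum_right S_sum)
  also have "\<dots> = (\<Sum>m\<in>L. ip (g m) (g m)) + 2 * (\<Sum>m\<in>L. \<Sum>l\<in>{l\<in>L. l < m}. ip (g m) (g l))"
    by (rule sum_symmetric_split[OF L]) (rule ip_commute)
  also have "(\<Sum>m\<in>L. ip (g m) (g m)) \<le> (\<Sum>m\<in>L. 1)"
  proof (rule sum_mono)
    fix m
    have "nrm (g m) \<le> 1"
      unfolding g_def using V by (intro order_trans[OF nrm_ap_part_le])
    then show "ip (g m) (g m) \<le> 1"
      using S nrm_nonneg[OF S] by (simp add: power_le_one flip: nrm_sq)
  qed
  also have "(\<Sum>m\<in>L. \<Sum>l\<in>{l\<in>L. l < m}. ip (g m) (g l))
      \<le> (\<Sum>m\<in>L. real (card {l\<in>L. l < m}) * (\<rho> + \<epsilon>) + sqrt (P + P\<^sup>2 * \<epsilon>))"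
    unfolding g_def P
    by (intro sum_mono good_shift_correlation[where c = c] V \<open>\<epsilon> \<ge> 0\<close> L good small)
  also have "\<dots> = (\<Sum>m\<in>L. \<Sum>l\<in>{l\<in>L. l < m}. 1) * (\<rho> + \<epsilon>) + P * sqrt (P + P\<^sup>2 * \<epsilon>)"
    by (simp add: sum.distrib P sum_distrib_right)
  finally have "P\<^sup>2 * \<mu>\<^sup>2 \<le> P + 2 * (\<Sum>m\<in>L. \<Sum>l\<in>{l\<in>L. l < m}. 1) * (\<rho> + \<epsilon>) + 2 * P * sqrt (P + P\<^sup>2 * \<epsilon>)"
    by (simp add: P algebra_simps)
  moreover have "P\<^sup>2 = P + 2 * (\<Sum>m\<in>L. \<Sum>l\<in>{l\<in>L. l < m}. 1)"
    using sum_symmetric_split[OF L, of "\<lambda>_ _. 1"] by (simp add: P power2_eq_square)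
  then have "2 * (\<Sum>m\<in>L. \<Sum>l\<in>{l\<in>L. l < m}. 1) * (\<rho> + \<epsilon>) \<le> P\<^sup>2 * (\<rho> + \<epsilon>)"
    using \<open>\<epsilon> \<ge> 0\<close> \<open>\<rho> \<ge> 0\<close> by (intro mult_right_mono) (auto simp: P)
  ultimately show ?thesis
    by linarith
qed

end

section \<open>Actions of the affine semigroup\<close>

lemma add_map_in_affine_semigroup: "add_map v \<in> affine_semigroup"
  unfolding affine_semigroup_def add_map_def
  by (intro CollectI exI[of _ 1] exI[of _ v]) simp

lemma mult_map_in_affine_semigroup: "u \<noteq> 0 \<Longrightarrow> mult_map u \<in> affine_semigroup"
  unfolding mult_map_def by (rule scaling_in_affine_semigroup)

lemma id_eq_add_map: "id = add_map 0"
  by (auto simp: add_map_def)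

lemma id_in_affine_semigroup: "id \<in> affine_semigroup"
  unfolding id_eq_add_map by (rule add_map_in_affine_semigroup)

locale measure_action = prob_space M
  for M :: "'w measure" +
  fixes T :: "('a::large_ideal_domain \<Rightarrow> 'a) \<Rightarrow> 'w \<Rightarrow> 'w"
  assumes action: "measure_preserving_action M T"
begin

text \<open>The action is constrained only on \<open>space M\<close>. Fixing the value
  \<open>0\<close> elsewhere lets the laws for pullbacks hold as equalities of functions.\<close>

definition pullback :: "('a \<Rightarrow> 'a) \<Rightarrow> ('w \<Rightarrow> real) \<Rightarrow> 'w \<Rightarrow> real" where
  "pullback g f \<omega> = (if \<omega> \<in> space M then f (T g \<omega>) else 0)"

lemma T_measurable: "g \<in> affine_semigroup \<Longrightarrow> T g \<in> M \<rightarrow>\<^sub>M M"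
  using action by (auto simp: measure_preserving_action_def)

lemma T_space: "g \<in> affine_semigroup \<Longrightarrow> \<omega> \<in> space M \<Longrightarrow> T g \<omega> \<in> space M"
  using T_measurable measurable_space by metis

lemma distr_T: "g \<in> affine_semigroup \<Longrightarrow> distr M M (T g) = M"
  using action T_measurable[of g]
  by (intro measure_eqI) (auto simp: measure_preserving_action_def emeasure_distr)

lemma pullback_pullback:
  assumes "g \<in> affine_semigroup" "h \<in> affine_semigroup"
  shows "pullback g (pullback h f) = pullback (h \<circ> g) f"
proof
  fix \<omega>
  show "pullback g (pullback h f) \<omega> = pullback (h \<circ> g) f \<omega>"
    using action assms T_space[OF assms(1)]
    by (simp add: pullback_def measure_preserving_action_def)
qed

lemma pullback_linear:
  "pullback g (f + f') = pullback g f + pullback g f'"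
  "pullback g (a *\<^sub>R f) = a *\<^sub>R pullback g f"
  "pullback g 0 = 0"
  "pullback g (f - f') = pullback g f - pullback g f'"
  by (auto simp: pullback_def fun_eq_iff)

lemma pullback_measurable:
  assumes "g \<in> affine_semigroup" "f \<in> borel_measurable M"
  shows "pullback g f \<in> borel_measurable M"
proof -
  have "(\<lambda>\<omega>. f (T g \<omega>)) \<in> borel_measurable M"
    using T_measurable[OF assms(1)] assms(2) by (rule measurable_compose)
  then show ?thesis
    by (rule measurable_cong[THEN iffD1, rotated]) (simp add: pullback_def)
qed

lemma integral_pullback:
  assumes "g \<in> affine_semigroup" "f \<in> borel_measurable M"
  shows "(\<integral>\<omega>. pullback g f \<omega> \<partial>M) = (\<integral>\<omega>. f \<omega> \<partial>M)"
proof -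
  have "(\<integral>\<omega>. pullback g f \<omega> \<partial>M) = (\<integral>\<omega>. f (T g \<omega>) \<partial>M)"
    by (rule Bochner_Integration.integral_cong) (auto simp: pullback_def)
  also have "\<dots> = (\<integral>\<omega>. f \<omega> \<partial>distr M M (T g))"
    using T_measurable[OF assms(1)] assms(2) by (simp add: integral_distr)
  finally show ?thesis
    by (simp add: distr_T[OF assms(1)])
qed

lemma integrable_pullback:
  assumes "g \<in> affine_semigroup" "integrable M f"
  shows "integrable M (pullback g f)"
proof -
  have "integrable (distr M M (T g)) f"
    using assms by (simp add: distr_T)
  then have "integrable M (\<lambda>\<omega>. f (T g \<omega>))"
    using T_measurable[OF assms(1)] assms(2) by (simp add: integrable_distr_eq)
  then show ?thesis
    by (rule Bochner_Integration.integrable_cong[THEN iffD1, rotated 2]) (auto simp: pullback_def)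
qed

lemma pullback_mult: "pullback g f \<omega> * pullback g f' \<omega> = pullback g (\<lambda>\<omega>. f \<omega> * f' \<omega>) \<omega>"
  by (simp add: pullback_def)

lemma pullback_L2:
  assumes g: "g \<in> affine_semigroup" and f: "f \<in> L2 M"
  shows "pullback g f \<in> L2 M"
  using integrable_pullback[OF g L2_integrable_square[OF f]] pullback_measurable[OF g L2_measurable[OF f]]
  by (simp add: L2_def power2_eq_square pullback_mult)

lemma pullback_inner:
  assumes "g \<in> affine_semigroup" "f \<in> L2 M" "f' \<in> L2 M"
  shows "L2_inner M (pullback g f) (pullback g f') = L2_inner M f f'"
  unfolding L2_inner_def pullback_mult using assms
  by (intro integral_pullback) (auto dest!: L2_measurable)

text \<open>The map \<open>T id\<close> is only almost everywhere the identity; on the functions fixed by its pullback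
  the additive group acts by honest isometries.\<close>

definition fixed_L2 :: "('w \<Rightarrow> real) set" where
  "fixed_L2 = {f \<in> L2 M. pullback id f = f}"

lemma fixed_L2_in: "f \<in> fixed_L2 \<Longrightarrow> f \<in> L2 M"
  by (simp add: fixed_L2_def)

lemma pullback_fixed_L2: "g \<in> affine_semigroup \<Longrightarrow> f \<in> L2 M \<Longrightarrow> pullback g f \<in> fixed_L2"
  using pullback_pullback[OF id_in_affine_semigroup, of g f] by (simp add: fixed_L2_def pullback_L2)

lemma subspace_fixed_L2: "subspace fixed_L2"
  using subspace_L2[of M]
  by (auto simp: subspace_def fixed_L2_def pullback_linear)

lemma semi_hilbert_fixed_L2: "semi_hilbert fixed_L2 (L2_inner M)"
proof -
  interpret L: semi_inner "L2 M" "L2_inner M"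
    by (rule semi_inner_L2)
  show ?thesis
  proof
    fix X :: "nat \<Rightarrow> 'w \<Rightarrow> real"
    assume X: "\<And>n. X n \<in> fixed_L2"
      and Cauchy: "\<And>e. e > 0 \<Longrightarrow> \<exists>N. \<forall>m\<ge>N. \<forall>n\<ge>N. L2_inner M (X m - X n) (X m - X n) < e"
    have XL: "X n \<in> L2 M" for n
      using X fixed_L2_in by blast
    obtain l where l: "l \<in> L2 M" "(\<lambda>n. L2_inner M (X n - l) (X n - l)) \<longlonglongrightarrow> 0"
      using L2_complete[OF XL Cauchy] by blast
    \<comment> \<open>The limit \<open>l\<close> need not be fixed; its pullback by
      \<open>id\<close> is, and lies at the same distance from every \<open>X n\<close>.\<close>
    have "X n - pullback id l = pullback id (X n - l)" for n
      using X by (simp add: pullback_linear fixed_L2_def)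
    then have "L2_inner M (X n - pullback id l) (X n - pullback id l) = L2_inner M (X n - l) (X n - l)" for n
      using pullback_inner[OF id_in_affine_semigroup] XL l(1) by simp
    then show "\<exists>l\<in>fixed_L2. (\<lambda>n. L2_inner M (X n - l) (X n - l)) \<longlonglongrightarrow> 0"
      using l pullback_fixed_L2[OF id_in_affine_semigroup l(1)] by (intro bexI[of _ "pullback id l"]) auto
  next
    fix P :: "(('w \<Rightarrow> real) \<times> ('w \<Rightarrow> real)) list"
    assume "set P \<subseteq> fixed_L2 \<times> fixed_L2"
    then show "0 \<le> (\<Sum>p\<leftarrow>P. \<Sum>q\<leftarrow>P. L2_inner M (fst p) (fst q) * L2_inner M (snd p) (snd q))"
      using fixed_L2_in by (intro schur_L2) blast
  qed (auto simp: subspace_fixed_L2 fixed_L2_in L.ip_add_left L.ip_scale_left L.ip_nonneg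
      intro: L.ip_commute)
qed

sublocale additive_rep fixed_L2 "L2_inner M" "\<lambda>v. pullback (add_map v)"
proof -
  interpret semi_hilbert fixed_L2 "L2_inner M"
    by (rule semi_hilbert_fixed_L2)
  show "additive_rep fixed_L2 (L2_inner M) (\<lambda>v. pullback (add_map v))"
  proof
    fix x v w
    assume x: "x \<in> fixed_L2"
    \<comment> \<open>Pullback reverses composition, which is invisible here since addition is
      commutative.\<close>
    show "pullback (add_map v) (pullback (add_map w) x) = pullback (add_map (v + w)) x"
      by (simp add: pullback_pullback add_map_in_affine_semigroup)
         (simp add: add_map_def o_def add.assoc)
    show "pullback (add_map 0) x = x"
      using x by (simp add: fixed_L2_def id_eq_add_map)
  qed (auto simp: fixed_L2_in pullback_fixed_L2 pullback_inner pullback_linear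
      add_map_in_affine_semigroup)
qed

section \<open>Dilated indicator functions and their correlations\<close>

definition scaled_indicator :: "'w set \<Rightarrow> 'a \<Rightarrow> 'w \<Rightarrow> real" where
  "scaled_indicator B b = pullback (mult_map b) (indicator B)"

lemma indicator_L2: "B \<in> sets M \<Longrightarrow> indicator B \<in> L2 M"
  by (auto simp: L2_def power2_eq_square emeasure_eq_measure simp flip: indicator_inter_arith
      intro!: integrable_real_indicator)

lemma pullback_indicator:
  "pullback g (indicator B) \<omega> = indicator (T g -` B \<inter> space M) \<omega>"
  by (auto simp: pullback_def indicator_def)

lemma
  assumes "B \<in> sets M" "b \<noteq> 0"
  shows scaled_indicator_in: "scaled_indicator B b \<in> fixed_L2"
    and nrm_scaled_indicator: "nrm (scaled_indicator B b) \<le> 1"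
    and ip_scaled_indicator_1: "L2_inner M (scaled_indicator B b) (indicator (space M)) = measure M B"
proof -
  have g: "mult_map b \<in> affine_semigroup"
    using assms(2) by (rule mult_map_in_affine_semigroup)
  show "scaled_indicator B b \<in> fixed_L2"
    unfolding scaled_indicator_def by (intro pullback_fixed_L2 g indicator_L2 assms)
  have "L2_inner M (scaled_indicator B b) (scaled_indicator B b) = L2_inner M (indicator B) (indicator B)"
    unfolding scaled_indicator_def by (intro pullback_inner g indicator_L2 assms)
  also have "\<dots> = measure M B"
    using assms(1) by (simp add: L2_inner_def flip: indicator_inter_arith)
  finally show "nrm (scaled_indicator B b) \<le> 1"
    by (simp add: nrm_def)
  have "L2_inner M (scaled_indicator B b) (indicator (space M)) = (\<integral>\<omega>. pullback (mult_map b) (indicator B) \<omega> \<partial>M)"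
    unfolding L2_inner_def by (rule Bochner_Integration.integral_cong) (auto simp: scaled_indicator_def)
  also have "\<dots> = measure M B"
    using assms(1) by (simp add: integral_pullback g)
  finally show "L2_inner M (scaled_indicator B b) (indicator (space M)) = measure M B" .
qed

lemma
  shows indicator_space_in: "indicator (space M) \<in> fixed_L2"
    and nrm_indicator_space: "nrm (indicator (space M)) \<le> 1"
    and pullback_indicator_space:
      "pullback (add_map v) (indicator (space M)) = indicator (space M)"
proof -
  have inv: "pullback g (indicator (space M)) = indicator (space M)" if "g \<in> affine_semigroup" for g
    using T_space[OF that] by (auto simp: pullback_def fun_eq_iff)
  then show "pullback (add_map v) (indicator (space M)) = indicator (space M)"
    by (simp add: add_map_in_affine_semigroup)
  show "indicator (space M) \<in> fixed_L2"
    using inv[OF id_in_affine_semigroup] indicator_L2[of "space M"] by (simp add: fixed_L2_def)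
  show "nrm (indicator (space M)) \<le> 1"
    by (simp add: nrm_def L2_inner_def prob_space flip: indicator_inter_arith)
qed

text \<open>By \<open>b (x + c) = b x + b c\<close>, shifting \<open>V_b\<close> by \<open>c\<close>
  amounts to pulling back along \<open>A_(bc)\<close> and then along \<open>M_b\<close>; likewise
  \<open>V_(bbc)\<close> comes from \<open>M_(bc)\<close> and then \<open>M_b\<close>. Pullback
  along \<open>M_b\<close> preserves inner products, so it drops out and \<open>u = b * c\<close>
  remains.\<close>

lemma correlation_eq_measure:
  assumes B: "B \<in> sets M" and b: "b \<noteq> 0" and u: "b * c \<noteq> 0"
  shows "L2_inner M (scaled_indicator B (b * b * c)) (pullback (add_map c) (scaled_indicator B b))
    = measure M ((T (mult_map (b * c)) -` B \<inter> space M) \<inter> (T (add_map (b * c)) -` B \<inter> space M))"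
proof -
  let ?f = "indicator B :: 'w \<Rightarrow> real"
  note aff = mult_map_in_affine_semigroup[OF b] mult_map_in_affine_semigroup[OF u]
    add_map_in_affine_semigroup[of "b * c"] add_map_in_affine_semigroup[of c]
  have "scaled_indicator B (b * b * c) = pullback (mult_map b) (pullback (mult_map (b * c)) ?f)"
    by (simp add: scaled_indicator_def pullback_pullback aff) (simp add: mult_map_def o_def mult_ac)
  moreover have "pullback (add_map c) (scaled_indicator B b) = pullback (mult_map b) (pullback (add_map (b * c)) ?f)"
    by (simp add: scaled_indicator_def pullback_pullback aff)
       (simp add: mult_map_def add_map_def o_def distrib_left)
  ultimately have "L2_inner M (scaled_indicator B (b * b * c)) (pullback (add_map c) (scaled_indicator B b))
      = L2_inner M (pullback (mult_map (b * c)) ?f) (pullback (add_map (b * c)) ?f)"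
    using B by (simp add: pullback_inner pullback_L2 indicator_L2 aff)
  also have "\<dots> = measure M ((T (mult_map (b * c)) -` B \<inter> space M) \<inter> (T (add_map (b * c)) -` B \<inter> space M))"
    using measurable_sets[OF T_measurable[OF aff(2)] B] measurable_sets[OF T_measurable[OF aff(3)] B]
    by (simp add: L2_inner_def pullback_indicator Int_ac flip: indicator_inter_arith)
  finally show ?thesis .
qed

text \<open>Norm and projection belong to a single system; this wrapper lets statements about
  several systems mention them outside the locale.\<close>

definition good_step :: "real \<Rightarrow> 'w set \<Rightarrow> (nat \<Rightarrow> 'a) \<Rightarrow> nat \<Rightarrow> (nat \<Rightarrow> 'a) \<Rightarrow> bool" where
  "good_step \<epsilon> B b = good_shift \<epsilon> (\<lambda>l. scaled_indicator B (b l))"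

end

section \<open>The recurrent sequence\<close>

text \<open>As there is no division in the ring, \<open>c l\<close> plays the role of \<open>b_m / b_l\<^sup>2\<close> and \<open>b l * c l\<close> that of
  \<open>b_m / b_l\<close>; \<open>bm\<close> is the new term of the sequence.\<close>

definition recurrent_step ::
    "nat \<Rightarrow> (nat \<Rightarrow> 'w measure) \<Rightarrow> (nat \<Rightarrow> ('a::large_ideal_domain \<Rightarrow> 'a) \<Rightarrow> 'w \<Rightarrow> 'w) \<Rightarrow>
      (nat \<Rightarrow> 'w set) \<Rightarrow> 'a set \<Rightarrow> real \<Rightarrow> (nat \<Rightarrow> 'a) \<Rightarrow> nat \<Rightarrow> 'a \<Rightarrow> (nat \<Rightarrow> 'a) \<Rightarrow> bool" where
  "recurrent_step t M T B E \<epsilon> b m bm c \<longleftrightarrow> bm \<noteq> 0 \<and>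
     (\<forall>l<m. bm = b l * b l * c l \<and> b l * c l \<in> E) \<and>
     (\<forall>i\<in>{1..t}. measure_action.good_step (M i) (T i) \<epsilon> (B i) b m c)"

text \<open>With the new term \<open>D * x\<close>, every requirement becomes a condition on
  \<open>x\<close> of the kind that \<open>thick_recurrence\<close> supplies: some dilates lie in
  \<open>E\<close>, and one colouring and one null function serve all systems at once.\<close>

lemma recurrent_step_exists:
  fixes E :: "'a::large_ideal_domain set" and b :: "nat \<Rightarrow> 'a"
  assumes act: "\<And>i. i \<in> {1..t} \<Longrightarrow> measure_action (M i) (T i)"
    and B: "\<And>i. i \<in> {1..t} \<Longrightarrow> B i \<in> sets (M i)"
    and E: "thick E" "0 \<notin> E" "1 \<notin> E" "- 1 \<notin> E" and "\<epsilon> > 0"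
    and b: "\<And>l. l < m \<Longrightarrow> b l \<noteq> 0"
      "\<And>l l'. l < l' \<Longrightarrow> l' < m \<Longrightarrow> \<exists>c. b l' = b l * b l * c \<and> b l * c \<in> E"
  shows "\<exists>bm c. recurrent_step t M T B E \<epsilon> b m bm c"
proof -
  \<comment> \<open>\<open>d l\<close> stands for \<open>D / b_l\<^sup>2\<close>.\<close>
  define d where "d l = (\<Prod>j\<in>{..<m} - {l}. b j * b j)" for l
  define D where "D = (\<Prod>j<m. b j * b j)"
  have D: "D = b l * b l * d l" if "l < m" for l
    unfolding D_def d_def using that by (intro prod.remove) auto
  have d0: "d l \<noteq> 0" for l
    using b(1) by (auto simp: d_def)
  have "D \<noteq> 0"
    using b(1) by (auto simp: D_def)
  have d_distinct: "d l \<noteq> d l'" if l: "l < l'" "l' < m" for l l'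
  proof
    assume eq: "d l = d l'"
    obtain c where c: "b l' = b l * (b l * c)" "b l * c \<in> E"
      using b(2)[OF l] by (auto simp: mult.assoc)
    have "b l * b l * d l = b l' * b l' * d l"
      using D[of l] D[of l'] l eq by (metis order.strict_trans)
    then have "b l * b l * 1 = b l * b l * ((b l * c) * (b l * c))"
      using d0[of l] by (simp add: c(1) mult_ac)
    then have "(b l * c) * (b l * c) = 1"
      using b(1)[of l] l by simp
    then show False
      using c(2) E(3,4) by (auto simp: square_eq_1_iff)
  qed
  have "\<exists>r \<psi>. finitely_colourable r \<and> null_function \<psi> \<and>
      (\<forall>s t v w. r s t \<longrightarrow> r v w \<longrightarrow> \<psi> (s - t + (v - w)) \<le> \<epsilon>\<^sup>2 \<longrightarrow>
        measure_action.good_step (M i) (T i) \<epsilon> (B i) b m (\<lambda>l. d l * (s - t + (v - w))))"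
    if i: "i \<in> {1..t}" for i
  proof -
    interpret measure_action "M i" "T i"
      by (rule act[OF i])
    show ?thesis
      unfolding good_step_def
      by (rule good_shift_large[OF scaled_indicator_in[OF B[OF i] b(1)] d_distinct \<open>\<epsilon> > 0\<close>])
  qed
  then obtain r \<psi> where r: "\<And>i. i \<in> {1..t} \<Longrightarrow> finitely_colourable (r i)"
    and \<psi>: "\<And>i. i \<in> {1..t} \<Longrightarrow> null_function (\<psi> i)"
    and good: "\<And>i s u v w. i \<in> {1..t} \<Longrightarrow> r i s u \<Longrightarrow> r i v w \<Longrightarrow> \<psi> i (s - u + (v - w)) \<le> \<epsilon>\<^sup>2 \<Longrightarrow>
        measure_action.good_step (M i) (T i) \<epsilon> (B i) b m (\<lambda>l. d l * (s - u + (v - w)))"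
    by metis
  \<comment> \<open>The identity puts \<open>x\<close> itself into \<open>E\<close>, which makes the
    new term nonzero.\<close>
  define F where "F = insert (\<lambda>x. 1 * x) ((\<lambda>l x. (b l * d l) * x) ` {..<m})"
  have "finite F"
    by (simp add: F_def)
  have "F \<subseteq> affine_semigroup"
    unfolding F_def using b(1) d0 by (intro insert_subsetI image_subsetI scaling_in_affine_semigroup) auto
  have "\<epsilon>\<^sup>2 > 0"
    using \<open>\<epsilon> > 0\<close> by simp
  obtain s u v w where F: "\<forall>g\<in>F. g (s - u + (v - w)) \<in> E"
    and rr: "\<forall>i\<in>{1..t}. r i s u" "\<forall>i\<in>{1..t}. r i v w"
    and sum: "(\<Sum>i\<in>{1..t}. \<psi> i (s - u + (v - w))) \<le> \<epsilon>\<^sup>2"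
    by (rule thick_recurrence[OF E(1) \<open>finite F\<close> \<open>F \<subseteq> affine_semigroup\<close>
      finitely_colourable_Ball[where r = r, OF finite_atLeastAtMost r]
      null_function_sum[where f = \<psi>, OF finite_atLeastAtMost \<psi>] \<open>\<epsilon>\<^sup>2 > 0\<close>])
  define x where "x = s - u + (v - w)"
  have "1 * x \<in> E"
    using F unfolding F_def x_def by blast
  then have "D * x \<noteq> 0"
    using E(2) \<open>D \<noteq> 0\<close> by auto
  moreover have "D * x = b l * b l * (d l * x) \<and> b l * (d l * x) \<in> E" if "l < m" for l
  proof
    show "D * x = b l * b l * (d l * x)"
      using D[OF that] by (simp add: mult.assoc)
    have "(\<lambda>x. (b l * d l) * x) \<in> F"
      using that unfolding F_def by blast
    from bspec[OF F this] show "b l * (d l * x) \<in> E"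
      by (simp add: x_def mult.assoc)
  qed
  moreover have "measure_action.good_step (M i) (T i) \<epsilon> (B i) b m (\<lambda>l. d l * x)" if i: "i \<in> {1..t}" for i
  proof -
    have "\<psi> i x \<le> (\<Sum>i\<in>{1..t}. \<psi> i x)"
      using i \<psi> unfolding null_function_def by (intro member_le_sum) auto
    then show ?thesis
      using good[OF i, of s u v w] rr sum i by (simp add: x_def)
  qed
  ultimately have "recurrent_step t M T B E \<epsilon> b m (D * x) (\<lambda>l. d l * x)"
    unfolding recurrent_step_def by blast
  then show ?thesis
    by blast
qed

text \<open>A step depends on the earlier terms of \<open>b\<close> but not on the particular shifts
  used to find them, so the recursion chooses only \<open>b\<close>, and the shifts are picked
  afterwards.\<close>

lemma recurrent_sequence_exists:
  fixes E :: "'a::large_ideal_domain set"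
  assumes act: "\<And>i. i \<in> {1..t} \<Longrightarrow> measure_action (M i) (T i)"
    and B: "\<And>i. i \<in> {1..t} \<Longrightarrow> B i \<in> sets (M i)"
    and E: "thick E" "0 \<notin> E" "1 \<notin> E" "- 1 \<notin> E" and "\<epsilon> > 0"
  shows "\<exists>b c. \<forall>m. recurrent_step t M T B E \<epsilon> b m (b m) (c m)"
proof -
  have "\<exists>b. \<forall>m. \<exists>c. recurrent_step t M T B E \<epsilon> b m (b m) c"
  proof (rule dependent_wellorder_choice)
    fix m and b :: "nat \<Rightarrow> 'a"
    assume b: "\<And>l. l < m \<Longrightarrow> \<exists>c. recurrent_step t M T B E \<epsilon> b l (b l) c"
    have "\<exists>bm c. recurrent_step t M T B E \<epsilon> b m bm c"
    proof (rule recurrent_step_exists[where t = t and M = M and T = T and B = B, OF act B E \<open>\<epsilon> > 0\<close>])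
      show "b l \<noteq> 0" if "l < m" for l
        using b[OF that] by (auto simp: recurrent_step_def)
      show "\<exists>c. b l' = b l * b l * c \<and> b l * c \<in> E" if "l < l'" "l' < m" for l l'
        using b[OF that(2)] that(1) unfolding recurrent_step_def by blast
    qed
    then show "\<exists>bm. \<exists>c. recurrent_step t M T B E \<epsilon> b m bm c"
      by blast
  next
    fix bm m and b b' :: "nat \<Rightarrow> 'a"
    assume eq: "\<And>l. l < m \<Longrightarrow> b l = b' l"
    have "recurrent_step t M T B E \<epsilon> b m bm c = recurrent_step t M T B E \<epsilon> b' m bm c" for c
    proof -
      have "measure_action.good_step (M i) (T i) \<epsilon> (B i) b m c
        = measure_action.good_step (M i) (T i) \<epsilon> (B i) b' m c" if i: "i \<in> {1..t}" for i
      proof -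
        interpret measure_action "M i" "T i"
          by (rule act[OF i])
        show ?thesis
          unfolding good_step_def good_shift_def using eq by (simp cong: all_cong imp_cong)
      qed
      then show ?thesis
        unfolding recurrent_step_def using eq by (simp cong: all_cong imp_cong)
    qed
    then show "(\<exists>c. recurrent_step t M T B E \<epsilon> b m bm c) = (\<exists>c. recurrent_step t M T B E \<epsilon> b' m bm c)"
      by simp
  qed
  then show ?thesis
    by metis
qed

theorem theorem1p7:
  fixes t :: nat
    and M :: "nat \<Rightarrow> 'w measure"
    and T :: "nat \<Rightarrow> ('a::large_ideal_domain \<Rightarrow> 'a) \<Rightarrow> 'w \<Rightarrow> 'w"
    and B :: "nat \<Rightarrow> 'w set"
    and \<delta> :: real
  assumes "\<And>i. i \<in> {1..t} \<Longrightarrow> prob_space (M i)"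
    and "\<And>i. i \<in> {1..t} \<Longrightarrow> measure_preserving_action (M i) (T i)"
    and "\<And>i. i \<in> {1..t} \<Longrightarrow> B i \<in> sets (M i)"
    and "\<And>i. i \<in> {1..t} \<Longrightarrow> measure (M i) (B i) > 0"
    and "0 < \<delta>" and "\<delta> < 1"
  shows "affinely_syndetic (\<Inter>i\<in>{1..t}. return_set (M i) (T i) (B i) \<delta>)
       \<and> (\<Inter>i\<in>{1..t}. return_set (M i) (T i) (B i) \<delta>) \<noteq> {}"
proof -
  define S where "S = (\<Inter>i\<in>{1..t}. return_set (M i) (T i) (B i) \<delta>)"
  have act: "measure_action (M i) (T i)" if "i \<in> {1..t}" for i
    using assms(1,2)[OF that] by (simp add: measure_action_def measure_action_axioms_def)
  have "affinely_syndetic S"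
  proof (rule ccontr)
    assume nsynd: "\<not> affinely_syndetic S"
    define E where "E = - S - {0, 1, - 1}"
    have E: "thick E" "0 \<notin> E" "1 \<notin> E" "- 1 \<notin> E"
      using thick_if_not_syndetic[OF infinite_ring nsynd, of "{0, 1, - 1}"] by (auto simp: E_def)
    \<comment> \<open>The left side is the error that remains in
      \<open>correlation_lower_bound\<close> after division by \<open>n\<^sup>2\<close> when
      \<open>\<epsilon> = 1 / n\<close> and \<open>n\<close> indices are used.\<close>
    have "\<forall>\<^sub>F n in sequentially. 2 * (1 / real n) + 2 * sqrt (2 * (1 / real n)) < (1 - \<delta>) * (measure (M i) (B i))\<^sup>2"
      if "i \<in> {1..t}" for i
    proof (rule order_tendstoD)
      have "(\<lambda>n. 2 * (1 / real n) + 2 * sqrt (2 * (1 / real n))) \<longlonglongrightarrow> 2 * 0 + 2 * sqrt (2 * 0)"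
        by (intro tendsto_intros lim_1_over_n)
      then show "(\<lambda>n. 2 * (1 / real n) + 2 * sqrt (2 * (1 / real n))) \<longlonglongrightarrow> 0"
        by simp
      show "0 < (1 - \<delta>) * (measure (M i) (B i))\<^sup>2"
        using assms(4)[OF that] \<open>\<delta> < 1\<close> by simp
    qed
    then have "\<forall>\<^sub>F n in sequentially. \<forall>i\<in>{1..t}.
        2 * (1 / real n) + 2 * sqrt (2 * (1 / real n)) < (1 - \<delta>) * (measure (M i) (B i))\<^sup>2"
      by (intro eventually_ball_finite) auto
    then have "\<forall>\<^sub>F n in sequentially. n > 0 \<and> (\<forall>i\<in>{1..t}.
        2 * (1 / real n) + 2 * sqrt (2 * (1 / real n)) < (1 - \<delta>) * (measure (M i) (B i))\<^sup>2)"
      by (intro eventually_conj eventually_gt_at_top)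
    then obtain n where n: "n > 0" "\<And>i. i \<in> {1..t} \<Longrightarrow>
        2 * (1 / real n) + 2 * sqrt (2 * (1 / real n)) < (1 - \<delta>) * (measure (M i) (B i))\<^sup>2"
      using eventually_sequentially by auto
    define \<epsilon> where "\<epsilon> = 1 / real n"
    have "\<epsilon> > 0"
      using n(1) by (simp add: \<epsilon>_def)
    obtain b c where bc: "\<And>m. recurrent_step t M T B E \<epsilon> b m (b m) (c m)"
      using recurrent_sequence_exists[where t = t and M = M and T = T and B = B, OF act assms(3) E \<open>\<epsilon> > 0\<close>] by blast
    have b: "b m \<noteq> 0" for m
      using bc unfolding recurrent_step_def by blast
    have bm: "b m = b l * b l * c m l" "b l * c m l \<in> E" if "l < m" for l m
      using bc that unfolding recurrent_step_def by blast+
    define corr where "corr i m l = L2_inner (M i) (measure_action.scaled_indicator (M i) (T i) (B i) (b m))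
      (measure_action.pullback (M i) (T i) (add_map (c m l))
        (measure_action.scaled_indicator (M i) (T i) (B i) (b l)))" for i m l
    have "\<exists>i\<in>{1..t}. corr i m l \<le> \<delta> * (measure (M i) (B i))\<^sup>2" if "l < m" for l m
    proof -
      let ?u = "b l * c m l"
      have u: "?u \<noteq> 0"
        using bm(2)[OF that] E(2) by metis
      have "?u \<notin> S"
        using bm(2)[OF that] by (simp add: E_def)
      then obtain i where i: "i \<in> {1..t}" "?u \<notin> return_set (M i) (T i) (B i) \<delta>"
        unfolding S_def by blast
      interpret measure_action "M i" "T i"
        by (rule act[OF i(1)])
      have "corr i m l = measure (M i) ((T i (mult_map ?u) -` B i \<inter> space (M i)) \<inter> (T i (add_map ?u) -` B i \<inter> space (M i)))"
        unfolding corr_def bm(1)[OF that] by (rule correlation_eq_measure[OF assms(3)[OF i(1)] b u])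
      then have "corr i m l \<le> \<delta> * (measure (M i) (B i))\<^sup>2"
        using i(2) u by (simp add: return_set_def)
      then show ?thesis
        using i(1) by blast
    qed
    then obtain k where k: "\<And>l m. l < m \<Longrightarrow> k l m \<in> {1..t} \<and> corr (k l m) m l \<le> \<delta> * (measure (M (k l m)) (B (k l m)))\<^sup>2"
      by metis
    \<comment> \<open>Ramsey's theorem colours unordered pairs; \<open>Min\<close> and
      \<open>Max\<close> recover the order.\<close>
    define f where "f X = k (Min X) (Max X)" for X :: "nat set"
    have f: "f {l, m} = k (min l m) (max l m)" for l m
      by (simp add: f_def)
    have "\<forall>l\<in>UNIV. \<forall>m\<in>UNIV. l \<noteq> m \<longrightarrow> f {l, m} < Suc t"
      using k by (fastforce simp: f min_def max_def less_Suc_eq_le)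
    from Ramsey2[OF infinite_UNIV_nat this] obtain Y i where Y: "infinite Y"
        "\<forall>l\<in>Y. \<forall>m\<in>Y. l \<noteq> m \<longrightarrow> f {l, m} = i"
      by (elim exE conjE)
    obtain L where L: "finite L" "card L = n" "L \<subseteq> Y"
      using infinite_arbitrarily_large[OF Y(1)] by blast
    have ki: "k l m = i" if "l \<in> Y" "m \<in> Y" "l < m" for l m
      using Y(2)[rule_format, OF that(1,2)] that(3) by (simp add: f)
    \<comment> \<open>The colours were only bounded by \<open>Suc t\<close>, which admits
      \<open>0\<close>; an actual pair in \<open>Y\<close> shows that \<open>i\<close> is the index
      of a system.\<close>
    have "\<forall>l. \<exists>m>l. m \<in> Y"
      using Y(1) by (simp add: infinite_nat_iff_unbounded)
    then obtain l0 m0 where lm0: "l0 \<in> Y" "m0 \<in> Y" "l0 < m0"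
      by blast
    have i: "i \<in> {1..t}"
      using ki[OF lm0] k[OF lm0(3)] by simp
    interpret measure_action "M i" "T i"
      by (rule act[OF i])
    define \<mu> where "\<mu> = measure (M i) (B i)"
    have "(real n)\<^sup>2 * \<mu>\<^sup>2 \<le> real n + (real n)\<^sup>2 * (\<delta> * \<mu>\<^sup>2 + \<epsilon>) + 2 * real n * sqrt (real n + (real n)\<^sup>2 * \<epsilon>)"
    proof (rule correlation_lower_bound[where V = "\<lambda>l. scaled_indicator (B i) (b l)" and c = c
          and e = "indicator (space (M i))" and L = L])
      show "good_shift \<epsilon> (\<lambda>l. scaled_indicator (B i) (b l)) m (c m)" for m
        using bspec[OF conjunct2[OF conjunct2[OF bc[of m, unfolded recurrent_step_def]]] i]
        by (simp only: good_step_def)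
      show "L2_inner (M i) (scaled_indicator (B i) (b m)) (pullback (add_map (c m l)) (scaled_indicator (B i) (b l)))
          \<le> \<delta> * \<mu>\<^sup>2" if "l \<in> L" "m \<in> L" "l < m" for l m
        using k[OF that(3)] ki[of l m] that L(3) by (auto simp: corr_def \<mu>_def)
    qed (use assms(3)[OF i] b L \<open>\<epsilon> > 0\<close> \<open>0 < \<delta>\<close> in
      \<open>auto simp: \<mu>_def scaled_indicator_in nrm_scaled_indicator ip_scaled_indicator_1
        indicator_space_in nrm_indicator_space pullback_indicator_space\<close>)
    also have "real n + (real n)\<^sup>2 * \<epsilon> = (real n)\<^sup>2 * (2 * \<epsilon>)"
      using n(1) by (simp add: \<epsilon>_def power2_eq_square)
    also have "sqrt ((real n)\<^sup>2 * (2 * \<epsilon>)) = real n * sqrt (2 * \<epsilon>)"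
      by (simp add: real_sqrt_mult)
    also have "real n + (real n)\<^sup>2 * (\<delta> * \<mu>\<^sup>2 + \<epsilon>) + 2 * real n * (real n * sqrt (2 * \<epsilon>))
        = (real n)\<^sup>2 * (\<delta> * \<mu>\<^sup>2 + (2 * \<epsilon> + 2 * sqrt (2 * \<epsilon>)))"
      using n(1) by (simp add: \<epsilon>_def power2_eq_square algebra_simps)
    finally have "\<mu>\<^sup>2 \<le> \<delta> * \<mu>\<^sup>2 + (2 * \<epsilon> + 2 * sqrt (2 * \<epsilon>))"
      using n(1) by simp
    moreover have "2 * \<epsilon> + 2 * sqrt (2 * \<epsilon>) < (1 - \<delta>) * \<mu>\<^sup>2"
      using n(2)[OF i] by (simp add: \<epsilon>_def \<mu>_def)
    ultimately show False
      by (simp add: algebra_simps)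
  qed
  moreover from this have "S \<noteq> {}"
    unfolding affinely_syndetic_def by blast
  ultimately show ?thesis
    by (simp add: S_def)
qed

end
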